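(* Consider the Bayesian model $\big(p(x\mid[h],[g];f),\ \Pi_{H/H_0}\otimes\tilde\mu_{G/G_0}\big)$ with sampling density $p(x\mid[h],[g];f)$ with respect to $\lambda$ and prior $\Pi_{H/H_0}\otimes\tilde\mu_{G/G_0}$ on $H/H_0\times G/G_0$, where $\Pi_{H/H_0}$ is a (proper or improper) prior on $H/H_0$ and $\tilde\mu_{G/G_0}=\pi(m\mu_G)$ is a relatively invariant measure on $G/G_0$ with multiplier $m$. Put $\tilde\mu_G:=m\mu_G$. Assume $$\int_G \chi_G(g^{-1})f(g^{-1})\,\tilde\mu_G(dg)<\infty,$$ or equivalently $\int_G \chi_G(g)f(g)\{m(g)\Delta_G(g)\}^{-1}\mu_G(dg)<\infty$. Then the density kernel $$p(x,[h]\mid f):=\int_{G/G_0}p(x\mid[h],[g];f)\,\tilde\mu_{G/G_0}(d[g])$$ of $(x,[h])$ with respect to $\lambda\otimes\Pi_{H/H_0}$ is proportional (as a function of $(x,[h])$) to $p(x,[h])$ defined by $$p(x,[h]):=\frac{1}{\chi_H(h)\,\tilde\chi_G(r(h^{-1}x))\,\tilde\chi_G(s(z(h^{-1}x)))},$$ where $\tilde\chi_G:=\chi_G/m$.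
   Context: Spaces and groups. A group $H$ acts on a space $\mathcal X$ to the left, $(h,x)\mapsto hx$, and another group $G$ acts on a subspace $\mathcal X_*\subseteq\mathcal X$ to the left, $(g,x)\mapsto gx$. $\mathcal X$ and $\mathcal X_*$ are locally compact Hausdorff spaces; $H$ and $G$ are second countable, locally compact Hausdorff topological groups; both actions are continuous. Orbital decomposition. $r:\mathcal X_*\to G$ satisfies $r(gx)=g\,r(x)$ for $g\in G$, $x\in\mathcal X_*$. Put $z(x):=\{r(x)\}^{-1}x$ for $x\in\mathcal X_*$ and $\mathcal Z:=\{z(x):x\in\mathcal X_*\}$. Then every $x\in\mathcal X_*$ is uniquely written $x=gz$ with $g\in G$, $z\in\mathcal Z$ (namely $g=r(x)$, $z=z(x)$), so $\mathcal X_*$ is in one-to-one correspondence with $G\times\mathcal Z$. Dominating measure. $\lambda$ is a measure on $\mathcal X$, relatively invariant under $H$ with multiplier $\chi_H$: $\lambda(d(hx))=\chi_H(h)\lambda(dx)$, $h\in H$. Its restriction to $\mathcal X_*$ is relatively invariant under $G$ with multiplier $\chi_G$: $\lambda(d(gx))=\chi_G(g)\lambda(dx)$, $g\in G$. (Multipliers are continuous homomorphisms into the multiplicative group of positive reals.) It is assumed that $\lambda(\mathcal X\setminus h\mathcal X_* )=0$ for each $h\in H$, where $h\mathcal X_*=\{hx:x\in\mathcal X_*\}$; hence expressions involving $r(h^{-1}x)$ or $z(h^{-1}x)$ are defined for $\lambda$-almost every $x$, and identities are understood outside these null sets. $\mu_G$ is a left invariant measure on $G$ (unique up to a multiplicative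 constant), and $\Delta_G$ is the right-hand modulus of $G$: $\mu_G(d(gg'))=\Delta_G(g')\mu_G(dg)$, $g'\in G$. It is assumed that there is a measure $\nu_{\mathcal Z}$ on $\mathcal Z$ such that $\lambda=\chi_G\mu_G\otimes\nu_{\mathcal Z}$ under the correspondence $\mathcal X_*\ni x\leftrightarrow (r(x),z(x))\in G\times\mathcal Z$. Sampling model. Given $s:\mathcal Z\to G$ and $f:G\to\mathbb R_{\ge 0}$ with $\int_{\mathcal X_*} f(r(x)s(z(x)))\,\lambda(dx)=1$, for $h\in H$, $g\in G$ define the density with respect to $\lambda$ on $\mathcal X_*$ $$p(x\mid h,g;f)=\frac{1}{\chi_H(h)\chi_G(g)}\,f\big(g^{-1}r(h^{-1}x)\,s(z(h^{-1}x))\big).$$ It is assumed that there are compact subgroups $H_0\subseteq H$ and $G_0\subseteq G$ such that $f(g_0g)=f(g)$ for all $g\in G$, $g_0\in G_0$, and $r(h_0x)=r(x)$, $s(z(h_0x))=s(z(x))$ for all $x\in\mathcal X_*$, $h_0\in H_0$ (up to $\lambda$-null sets where $h_0x\notin\mathcal X_*$). Write $[h]=hH_0$, $[g]=gG_0$ for left cosets and $H/H_0$, $G/G_0$ for the left coset spaces; then $p(\cdot\mid h,g;f)$ depends on $(h,g)$ only through $([h],[g])$ and is also written $p(\cdot\mid[h],[g];f)$. Only those $f$ are considered for which $p(\cdot\mid[h],[g];f)$ and $p(\cdot\mid[h'],[g'];f)$ give the same distribution if and only if $([h],[g])=([h'],[g'])$. Prior. $m$ is a multiplier on $G$ (a continuous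 homomorphism from $G$ into the multiplicative group of positive reals), $\pi:G\to G/G_0$ is the coset projection, and $\tilde\mu_{G/G_0}:=\pi(m\mu_G)$ is the image under $\pi$ of the measure $m(g)\mu_G(dg)$; it satisfies $\tilde\mu_{G/G_0}(d(g'[g]))=m(g')\tilde\mu_{G/G_0}(d[g])$ for $g'\in G$, where $g'[g]=[g'g]$. The expression $p(x,[h])$ depends on $h$ only through $[h]$, because $\chi_H=1$ on the compact subgroup $H_0$ and $r$, $s\circ z$ are $H_0$-invariant. "Proportional" means equal up to a multiplicative constant not depending on $(x,[h])$. All maps are measurable (the correspondence $\mathcal X_*\leftrightarrow G\times\mathcal Z$ in both directions) and all measures are $\sigma$-finite. *)

theory Defs
  imports "HOL-Analysis.Analysis" "HOL-Algebra.Left_Coset" "HOL-Algebra.Group_Action"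
begin

definition borel_of :: "'a topology \<Rightarrow> 'a measure" where
  "borel_of T = sigma (topspace T) {U. openin T U}"

locale lcsc_group = group G for G :: "('a, 'b) monoid_scheme" (structure) +
  fixes T :: "'a topology"
  assumes topspace_eq: "topspace T = carrier G"
    and continuous_mult: "continuous_map (prod_topology T T) T (\<lambda>(x, y). x \<otimes> y)"
    and continuous_inv: "continuous_map T T (\<lambda>x. inv x)"
    and Hausdorff: "Hausdorff_space T"
    and locally_compact: "locally_compact_space T"
    and second_countable: "second_countable T"

locale continuous_action = group_action G "topspace X" \<phi>
  for G :: "('a, 'b) monoid_scheme" (structure)
    and T :: "'a topology" and X :: "'x topology" and \<phi> :: "'a \<Rightarrow> 'x \<Rightarrow> 'x" +
  assumes continuous_act: "continuous_map (prod_topology T X) X (\<lambda>(g, x). \<phi> g x)"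

definition multiplier :: "('a, 'b) monoid_scheme \<Rightarrow> 'a topology \<Rightarrow> ('a \<Rightarrow> real) \<Rightarrow> bool" where
  "multiplier G T \<kappa> \<longleftrightarrow>
     continuous_map T euclideanreal \<kappa> \<and>
     (\<forall>g\<in>carrier G. 0 < \<kappa> g) \<and>
     (\<forall>g\<in>carrier G. \<forall>g'\<in>carrier G. \<kappa> (g \<otimes>\<^bsub>G\<^esub> g') = \<kappa> g * \<kappa> g')"

text \<open>\<open>M(d(gx)) = \<kappa>(g) M(dx)\<close>, evaluated on measurable sets.\<close>

definition relatively_invariant ::
  "('a, 'b) monoid_scheme \<Rightarrow> ('a \<Rightarrow> 'x \<Rightarrow> 'x) \<Rightarrow> ('a \<Rightarrow> real) \<Rightarrow> 'x measure \<Rightarrow> bool" where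
  "relatively_invariant G \<phi> \<kappa> M \<longleftrightarrow>
     (\<forall>g\<in>carrier G. \<forall>A\<in>sets M. emeasure M (\<phi> g ` A) = ennreal (\<kappa> g) * emeasure M A)"

definition left_invariant :: "('a, 'b) monoid_scheme \<Rightarrow> 'a measure \<Rightarrow> bool" where
  "left_invariant G M \<longleftrightarrow>
     (\<forall>g\<in>carrier G. \<forall>A\<in>sets M. emeasure M (g <#\<^bsub>G\<^esub> A) = emeasure M A)"

definition right_modulus :: "('a, 'b) monoid_scheme \<Rightarrow> 'a measure \<Rightarrow> ('a \<Rightarrow> real) \<Rightarrow> bool" where
  "right_modulus G M \<Delta> \<longleftrightarrow>
     (\<forall>g\<in>carrier G. 0 < \<Delta> g \<and>
        (\<forall>A\<in>sets M. emeasure M (A #>\<^bsub>G\<^esub> g) = ennreal (\<Delta> g) * emeasure M A))"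

text \<open>The quotient topology on the left coset space. A set \<open>U\<close> of cosets is a set of subsets
  of the group, and its preimage under \<open>g \<mapsto> gK\<close> is \<open>\<Union>U\<close>.\<close>

definition coset_topology ::
  "('a, 'b) monoid_scheme \<Rightarrow> 'a topology \<Rightarrow> 'a set \<Rightarrow> 'a set topology" where
  "coset_topology G T K = topology (\<lambda>U. U \<subseteq> lcosets\<^bsub>G\<^esub> K \<and> openin T (\<Union>U))"

lemma (in group) Union_Int_lcosets:
  assumes K: "subgroup K G" and U: "U \<subseteq> lcosets K" and V: "V \<subseteq> lcosets K"
  shows "\<Union>(U \<inter> V) = \<Union>U \<inter> \<Union>V"
proof
  show "\<Union>U \<inter> \<Union>V \<subseteq> \<Union>(U \<inter> V)"
  proof
    fix x assume "x \<in> \<Union>U \<inter> \<Union>V"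
    then obtain c d where c: "c \<in> U" "x \<in> c" and d: "d \<in> V" "x \<in> d" by auto
    obtain a where a: "a \<in> carrier G" "c = a <# K" using c U by (auto simp: LCOSETS_def)
    obtain b where b: "b \<in> carrier G" "d = b <# K" using d V by (auto simp: LCOSETS_def)
    have "c = x <# K" "d = x <# K"
      using l_repr_independence[OF _ _ K] a b c d by blast+
    then show "x \<in> \<Union>(U \<inter> V)" using c d by auto
  qed
qed auto

lemma (in group) openin_coset_topology:
  assumes "subgroup K G"
  shows "openin (coset_topology G T K) U \<longleftrightarrow> U \<subseteq> lcosets K \<and> openin T (\<Union>U)"
proof -
  have "istopology (\<lambda>U. U \<subseteq> lcosets K \<and> openin T (\<Union>U))"
    unfolding istopology_def
  proof (intro conjI allI impI)
    fix U V
    assume U: "U \<subseteq> lcosets K \<and> openin T (\<Union>U)" and V: "V \<subseteq> lcosets K \<and> openin T (\<Union>V)"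
    then show "U \<inter> V \<subseteq> lcosets K" by auto
    show "openin T (\<Union>(U \<inter> V))"
      using Union_Int_lcosets[OF assms] U V by auto
  next
    fix \<U> assume *: "\<forall>U\<in>\<U>. U \<subseteq> lcosets K \<and> openin T (\<Union>U)"
    then show "\<Union>\<U> \<subseteq> lcosets K" by auto
    have "\<Union>(\<Union>\<U>) = (\<Union>U\<in>\<U>. \<Union>U)" by auto
    then show "openin T (\<Union>(\<Union>\<U>))" using * by auto
  qed
  then show ?thesis
    unfolding coset_topology_def by (simp add: topology_inverse')
qed

lemma (in lcsc_group) quotient_map_coset_topology:
  assumes K: "subgroup K G"
  shows "quotient_map T (coset_topology G T K) (\<lambda>g. g <# K)"
proof -
  have Un: "\<Union>(lcosets K) = carrier G"
    using lcos_self[OF _ K] subgroup.lcosets_carrier[OF K group_axioms] by (auto simp: LCOSETS_def)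
  have "openin (coset_topology G T K) (lcosets K)"
    unfolding openin_coset_topology[OF K] Un topspace_eq[symmetric] by simp
  then have top: "topspace (coset_topology G T K) = lcosets K"
    using openin_coset_topology[OF K, of T "topspace (coset_topology G T K)"]
    by (intro subset_antisym) (auto dest: openin_subset)
  have "{g \<in> carrier G. g <# K \<in> U} = \<Union>U" if U: "U \<subseteq> lcosets K" for U
  proof
    show "{g \<in> carrier G. g <# K \<in> U} \<subseteq> \<Union>U" using lcos_self[OF _ K] by auto
    show "\<Union>U \<subseteq> {g \<in> carrier G. g <# K \<in> U}"
    proof
      fix x assume "x \<in> \<Union>U"
      then obtain c where c: "c \<in> U" "x \<in> c" by auto
      obtain a where a: "a \<in> carrier G" "c = a <# K" using c U by (auto simp: LCOSETS_def)
      have "c = x <# K" using l_repr_independence[OF _ _ K] a c by blast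
      moreover have "x \<in> carrier G" using c U Un by auto
      ultimately show "x \<in> {g \<in> carrier G. g <# K \<in> U}" using c by auto
    qed
  qed
  then show ?thesis
    unfolding quotient_map_def top topspace_eq
    by (auto simp: openin_coset_topology[OF K] LCOSETS_def)
qed

definition orbit_part ::
  "('g, 'c) monoid_scheme \<Rightarrow> ('g \<Rightarrow> 'x \<Rightarrow> 'x) \<Rightarrow> ('x \<Rightarrow> 'g) \<Rightarrow> 'x \<Rightarrow> 'x" where
  "orbit_part G \<psi> r x = \<psi> (inv\<^bsub>G\<^esub> r x) x"

text \<open>The density \<open>p(x | h, g; f)\<close>. It is set to 0 on the \<open>lam\<close>-null set of \<open>x\<close> with
  \<open>h\<^sup>-\<^sup>1x \<notin> Xs\<close>, where the formula is undefined.\<close>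

definition sampling_density ::
  "('h, 'b) monoid_scheme \<Rightarrow> ('g, 'c) monoid_scheme \<Rightarrow> ('h \<Rightarrow> 'x \<Rightarrow> 'x) \<Rightarrow> ('g \<Rightarrow> 'x \<Rightarrow> 'x) \<Rightarrow>
   'x set \<Rightarrow> ('h \<Rightarrow> real) \<Rightarrow> ('g \<Rightarrow> real) \<Rightarrow> ('x \<Rightarrow> 'g) \<Rightarrow> ('x \<Rightarrow> 'g) \<Rightarrow> ('g \<Rightarrow> real) \<Rightarrow>
   'x \<Rightarrow> 'h \<Rightarrow> 'g \<Rightarrow> real" where
  "sampling_density H G \<phi> \<psi> Xs \<chi>H \<chi>G r s f x h g =
     (let y = \<phi> (inv\<^bsub>H\<^esub> h) x in
      if y \<in> Xs
      then 1 / (\<chi>H h * \<chi>G g) * f (inv\<^bsub>G\<^esub> g \<otimes>\<^bsub>G\<^esub> r y \<otimes>\<^bsub>G\<^esub> s (orbit_part G \<psi> r y))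
      else 0)"

text \<open>\<open>p(x | [h], [g]; f)\<close>: the common value of \<open>p(x | h, g; f)\<close> over those representatives
  for which the formula is defined at \<open>x\<close>.\<close>

definition coset_sampling_density ::
  "('h, 'b) monoid_scheme \<Rightarrow> ('g, 'c) monoid_scheme \<Rightarrow> ('h \<Rightarrow> 'x \<Rightarrow> 'x) \<Rightarrow> ('g \<Rightarrow> 'x \<Rightarrow> 'x) \<Rightarrow>
   'x set \<Rightarrow> ('h \<Rightarrow> real) \<Rightarrow> ('g \<Rightarrow> real) \<Rightarrow> ('x \<Rightarrow> 'g) \<Rightarrow> ('x \<Rightarrow> 'g) \<Rightarrow> ('g \<Rightarrow> real) \<Rightarrow>
   'x \<Rightarrow> 'h set \<Rightarrow> 'g set \<Rightarrow> real" where
  "coset_sampling_density H G \<phi> \<psi> Xs \<chi>H \<chi>G r s f x c k =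
     (THE v. \<exists>h\<in>c. \<exists>g\<in>k. \<phi> (inv\<^bsub>H\<^esub> h) x \<in> Xs \<and>
        v = sampling_density H G \<phi> \<psi> Xs \<chi>H \<chi>G r s f x h g)"

text \<open>The image of \<open>m(g) \<mu>(dg)\<close> under the projection onto the left coset space.\<close>

definition coset_prior ::
  "('g, 'c) monoid_scheme \<Rightarrow> 'g topology \<Rightarrow> 'g set \<Rightarrow> ('g \<Rightarrow> real) \<Rightarrow> 'g measure \<Rightarrow>
   'g set measure" where
  "coset_prior G T K m \<mu> =
     distr (density \<mu> (\<lambda>g. ennreal (m g))) (borel_of (coset_topology G T K)) (\<lambda>g. g <#\<^bsub>G\<^esub> K)"

definition density_kernel ::
  "('h, 'b) monoid_scheme \<Rightarrow> ('g, 'c) monoid_scheme \<Rightarrow> ('h \<Rightarrow> 'x \<Rightarrow> 'x) \<Rightarrow> ('g \<Rightarrow> 'x \<Rightarrow> 'x) \<Rightarrow>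
   'x set \<Rightarrow> ('h \<Rightarrow> real) \<Rightarrow> ('g \<Rightarrow> real) \<Rightarrow> ('x \<Rightarrow> 'g) \<Rightarrow> ('x \<Rightarrow> 'g) \<Rightarrow> ('g \<Rightarrow> real) \<Rightarrow>
   'g set measure \<Rightarrow> 'x \<Rightarrow> 'h set \<Rightarrow> ennreal" where
  "density_kernel H G \<phi> \<psi> Xs \<chi>H \<chi>G r s f Q x c =
     (\<integral>\<^sup>+ k. ennreal (coset_sampling_density H G \<phi> \<psi> Xs \<chi>H \<chi>G r s f x c k) \<partial>Q)"

text \<open>The function \<open>p(x, [h])\<close>, first at a representative \<open>h\<close> (with \<open>\<kappa>\<close> for \<open>\<chi>\<^sub>G/m\<close>; meaningful
  for \<open>h\<^sup>-\<^sup>1x \<in> Xs\<close>), then as a function of the coset.\<close>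

definition reference_density ::
  "('h, 'b) monoid_scheme \<Rightarrow> ('g, 'c) monoid_scheme \<Rightarrow> ('h \<Rightarrow> 'x \<Rightarrow> 'x) \<Rightarrow> ('g \<Rightarrow> 'x \<Rightarrow> 'x) \<Rightarrow>
   ('h \<Rightarrow> real) \<Rightarrow> ('g \<Rightarrow> real) \<Rightarrow> ('x \<Rightarrow> 'g) \<Rightarrow> ('x \<Rightarrow> 'g) \<Rightarrow> 'x \<Rightarrow> 'h \<Rightarrow> real" where
  "reference_density H G \<phi> \<psi> \<chi>H \<kappa> r s x h =
     (let y = \<phi> (inv\<^bsub>H\<^esub> h) x in
      1 / (\<chi>H h * \<kappa> (r y) * \<kappa> (s (orbit_part G \<psi> r y))))"

definition coset_reference_density ::
  "('h, 'b) monoid_scheme \<Rightarrow> ('g, 'c) monoid_scheme \<Rightarrow> ('h \<Rightarrow> 'x \<Rightarrow> 'x) \<Rightarrow> ('g \<Rightarrow> 'x \<Rightarrow> 'x) \<Rightarrow>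
   'x set \<Rightarrow> ('h \<Rightarrow> real) \<Rightarrow> ('g \<Rightarrow> real) \<Rightarrow> ('x \<Rightarrow> 'g) \<Rightarrow> ('x \<Rightarrow> 'g) \<Rightarrow>
   'x \<Rightarrow> 'h set \<Rightarrow> real" where
  "coset_reference_density H G \<phi> \<psi> Xs \<chi>H \<kappa> r s x c =
     (THE v. \<exists>h\<in>c. \<phi> (inv\<^bsub>H\<^esub> h) x \<in> Xs \<and> v = reference_density H G \<phi> \<psi> \<chi>H \<kappa> r s x h)"

end

theory Submission
  imports Defs
begin

text \<open>Fix \<open>x\<close> and \<open>h\<close> with \<open>y = h\<^sup>-\<^sup>1x\<close> in the domain of \<open>r\<close>, and put \<open>a = r(y) s(z(y))\<close>. The integral over
  the coset space pulls back to \<open>\<integral> f(g\<^sup>-\<^sup>1a) / (\<chi>\<^sub>H(h) \<chi>\<^sub>G(g)) m(g) \<mu>(dg)\<close>, and the left translation \<open>g = au\<close>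
  turns this into \<open>m(a) / (\<chi>\<^sub>H(h) \<chi>\<^sub>G(a))\<close>, which is the reference density, times the constant
  \<open>\<integral> \<chi>\<^sub>G(u\<^sup>-\<^sup>1) f(u\<^sup>-\<^sup>1) m(u) \<mu>(du)\<close>. The constant is rewritten by
  \<open>\<integral> F(g\<^sup>-\<^sup>1) \<mu>(dg) = \<integral> F / \<Delta> d\<mu>\<close>, and it is positive because otherwise \<open>f\<close> would vanish almost everywhere,
  against the normalisation of the sampling density.\<close>

section \<open>Borel sets of an abstract topology\<close>

text \<open>Two measurability gaps shape the development. The density on \<open>G/G0\<close> is
  known to be measurable only after composition with the projection, and a set of cosets with Borel
  preimage is not evidently Borel in the quotient; so the pull-back is more than a change of
  variables. Likewise the pairs \<open>(x, c)\<close> for which no representative of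
  \<open>c\<close> carries \<open>x\<close> back into \<open>Xs\<close> are negligible for each
  fixed \<open>c\<close>, but need not form a measurable set, so Fubini does not apply to them
  directly. Compactness of \<open>G0\<close> settles the first gap, local compactness of
  \<open>Xs\<close> the second. Moreover \<open>\<Delta>\<close> enters only as a positive function
  with a scaling property on sets; that it is a measurable homomorphism has to be derived before the
  inversion formula. Finally, \<open>TX\<close> is not assumed to have a countable base, hence the
  care about which factor of a product is second countable.\<close>

lemma space_borel_of [simp]: "space (borel_of T) = topspace T"
  unfolding borel_of_def by (intro space_measure_of) (auto dest: openin_subset)

lemma sets_borel_of: "sets (borel_of T) = sigma_sets (topspace T) {U. openin T U}"
  unfolding borel_of_def by (intro sets_measure_of) (auto dest: openin_subset)

lemma borel_of_openin: "openin T U \<Longrightarrow> U \<in> sets (borel_of T)"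
  by (auto simp: sets_borel_of)

lemma borel_of_closedin: "closedin T C \<Longrightarrow> C \<in> sets (borel_of T)"
  by (metis borel_of_openin closedin_def double_diff order_refl sets.compl_sets space_borel_of)

lemma measurable_borel_ofI:
  assumes "f \<in> space M \<rightarrow> topspace T"
    and "\<And>U. openin T U \<Longrightarrow> f -` U \<inter> space M \<in> sets M"
  shows "f \<in> measurable M (borel_of T)"
  unfolding borel_of_def using assms by (intro measurable_measure_of) (auto dest: openin_subset)

lemma measurable_borel_of_continuous_map:
  assumes "continuous_map S T f"
  shows "f \<in> measurable (borel_of S) (borel_of T)"
proof (rule measurable_borel_ofI)
  show "f \<in> space (borel_of S) \<rightarrow> topspace T"
    using assms by (auto simp: continuous_map_def)
  fix U assume "openin T U"
  then have "openin S {x \<in> topspace S. f x \<in> U}"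
    using assms by (auto simp: continuous_map_def)
  then show "f -` U \<inter> space (borel_of S) \<in> sets (borel_of S)"
    by (intro borel_of_openin) (simp add: vimage_def Int_def conj_commute)
qed

lemma borel_measurable_continuous_map:
  fixes f :: "'a \<Rightarrow> 'b::topological_space"
  assumes "continuous_map S euclidean f"
  shows "f \<in> borel_measurable (borel_of S)"
proof -
  have "sets (borel_of (euclidean :: 'b topology)) = sets borel"
    by (simp add: sets_borel_of borel_def)
  then show ?thesis
    using measurable_borel_of_continuous_map[OF assms] measurable_cong_sets by blast
qed

text \<open>With a countable base for one factor only, rectangles are grouped by their side in that
  base: each \<open>V\<close> gets the single side \<open>U V\<close>, the union of all open sets
  that fit, so countably many rectangles cover \<open>W\<close> however large a base of
  \<open>S\<close> is.\<close>

lemma openin_prod_second_countable: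
  assumes "second_countable T" "openin (prod_topology S T) W"
  obtains \<B> U where "countable \<B>" "\<And>V. V \<in> \<B> \<Longrightarrow> openin T V" "\<And>V. openin S (U V)"
    "W = (\<Union>V\<in>\<B>. U V \<times> V)"
proof -
  obtain \<B> where \<B>: "countable \<B>" "\<And>V. V \<in> \<B> \<Longrightarrow> openin T V"
    "\<And>U x. openin T U \<Longrightarrow> x \<in> U \<Longrightarrow> \<exists>V\<in>\<B>. x \<in> V \<and> V \<subseteq> U"
    using assms(1) unfolding second_countable_def by metis
  define U where "U V = \<Union>{A. openin S A \<and> A \<times> V \<subseteq> W}" for V
  have "W = (\<Union>V\<in>\<B>. U V \<times> V)"
  proof
    show "W \<subseteq> (\<Union>V\<in>\<B>. U V \<times> V)"
    proof clarify
      fix x y assume "(x, y) \<in> W"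
      then obtain A B where AB: "openin S A" "openin T B" "x \<in> A" "y \<in> B" "A \<times> B \<subseteq> W"
        using assms(2)[unfolded openin_prod_topology_alt, rule_format, of x y] by auto
      then obtain V where "V \<in> \<B>" "y \<in> V" "V \<subseteq> B"
        using \<B>(3) by blast
      moreover from this AB have "x \<in> U V"
        unfolding U_def by blast
      ultimately show "(x, y) \<in> (\<Union>V\<in>\<B>. U V \<times> V)"
        by blast
    qed
  qed (auto simp: U_def)
  moreover have "openin S (U V)" for V
    unfolding U_def by auto
  ultimately show thesis
    using that \<B>(1,2) by blast
qed

lemma openin_prod_sets_pair_measure:
  assumes "second_countable T" "openin (prod_topology S T) W"
  shows "W \<in> sets (borel_of S \<Otimes>\<^sub>M borel_of T)"
proof -
  obtain \<B> U where *: "countable \<B>" "\<And>V. V \<in> \<B> \<Longrightarrow> openin T V" "\<And>V. openin S (U V)"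
    "W = (\<Union>V\<in>\<B>. U V \<times> V)"
    using openin_prod_second_countable[OF assms] by metis
  then show ?thesis
    by (auto intro!: sets.countable_UN' pair_measureI borel_of_openin)
qed

lemma measurable_pair_continuous_map:
  assumes "second_countable T" "continuous_map (prod_topology S T) Y f"
  shows "f \<in> measurable (borel_of S \<Otimes>\<^sub>M borel_of T) (borel_of Y)"
proof (rule measurable_borel_ofI)
  show "f \<in> space (borel_of S \<Otimes>\<^sub>M borel_of T) \<rightarrow> topspace Y"
    using assms(2) by (auto simp: continuous_map_def space_pair_measure)
  fix U assume "openin Y U"
  then have "openin (prod_topology S T) {x \<in> topspace (prod_topology S T). f x \<in> U}"
    using assms(2) by (auto simp: continuous_map_def)
  from openin_prod_sets_pair_measure[OF assms(1) this]
  show "f -` U \<inter> space (borel_of S \<Otimes>\<^sub>M borel_of T) \<in> sets (borel_of S \<Otimes>\<^sub>M borel_of T)"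
    by (simp add: vimage_def Int_def conj_commute space_pair_measure)
qed

text \<open>Base sets contained in a compact subset of \<open>U\<close> already cover
  \<open>U\<close>, since local compactness and Hausdorff separation give every point a compact
  neighbourhood inside \<open>U\<close>.\<close>

lemma openin_sigma_compact:
  assumes "second_countable T" "Hausdorff_space T" "locally_compact_space T" "openin T U"
  obtains K :: "nat \<Rightarrow> 'a set" where "\<And>n. compactin T (K n)" "U = (\<Union>n. K n)"
proof -
  obtain \<B> where \<B>: "countable \<B>" "\<And>V. V \<in> \<B> \<Longrightarrow> openin T V"
    "\<And>U x. openin T U \<Longrightarrow> x \<in> U \<Longrightarrow> \<exists>V\<in>\<B>. x \<in> V \<and> V \<subseteq> U"
    using assms(1) unfolding second_countable_def by metis
  define \<C> where "\<C> = {V \<in> \<B>. \<exists>K. compactin T K \<and> V \<subseteq> K \<and> K \<subseteq> U}"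
  have "\<forall>V\<in>\<C>. \<exists>K. compactin T K \<and> V \<subseteq> K \<and> K \<subseteq> U"
    by (auto simp: \<C>_def)
  then obtain k where k: "\<And>V. V \<in> \<C> \<Longrightarrow> compactin T (k V) \<and> V \<subseteq> k V \<and> k V \<subseteq> U"
    by metis
  have U: "U = (\<Union>V\<in>\<C>. k V)"
  proof
    show "U \<subseteq> (\<Union>V\<in>\<C>. k V)"
    proof
      fix x assume "x \<in> U"
      then obtain A K where "openin T A" "compactin T K" "x \<in> A" "A \<subseteq> K" "K \<subseteq> U"
        using assms locally_compact_space_neighbourhood_base[of T]
        unfolding neighbourhood_base_of by metis
      moreover then obtain V where "V \<in> \<B>" "x \<in> V" "V \<subseteq> A"
        using \<B>(3) by blast
      ultimately have "V \<in> \<C>" "x \<in> V"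
        by (auto simp: \<C>_def)
      then show "x \<in> (\<Union>V\<in>\<C>. k V)"
        using k by blast
    qed
  qed (use k in auto)
  \<comment> \<open>An empty \<open>\<C>\<close> forces \<open>U\<close> to be empty; it is treated
    apart because \<open>from_nat_into\<close> enumerates nonempty sets.\<close>
  define K where "K n = (if \<C> = {} then {} else k (from_nat_into \<C> n))" for n
  have c: "countable \<C>"
    using \<B>(1) by (auto simp: \<C>_def)
  have "U = (\<Union>n. K n)"
  proof (cases "\<C> = {}")
    case False
    have "(\<Union>V\<in>\<C>. k V) = (\<Union>n. k (from_nat_into \<C> n))"
      using range_from_nat_into[OF False c] by (metis image_image)
    then show ?thesis
      using U False by (simp add: K_def)
  qed (use U in \<open>auto simp: K_def\<close>)
  moreover have "compactin T (K n)" for n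
    using k from_nat_into[of \<C>] by (simp add: K_def)
  ultimately show thesis
    using that by blast
qed

section \<open>Inner regularity\<close>

text \<open>The geometric budget spends only half of \<open>e\<close>, leaving the other half for
  the truncation of a union.\<close>

lemma (in finite_measure) measure_UN_le_half:
  assumes "0 < e" "\<And>n. D n \<in> sets M" "\<And>n. measure M (D n) < e / 2 * (1 / 2) ^ Suc n"
  shows "measure M (\<Union>n. D n) \<le> e / 2"
proof -
  have s: "(\<lambda>n. e / 2 * (1 / 2) ^ Suc n) sums (e / 2)"
    using sums_mult[OF power_half_series, of "e / 2"] by simp
  have sm: "summable (\<lambda>n. measure M (D n))"
    by (rule summable_comparison_test'[OF sums_summable[OF s], of 0])
       (use assms(3) in \<open>auto intro: less_imp_le\<close>)
  have "measure M (\<Union>n. D n) \<le> (\<Sum>n. measure M (D n))"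
    using assms(2) sm by (intro finite_measure_subadditive_countably) auto
  also have "\<dots> \<le> e / 2"
    using suminf_le[OF less_imp_le[OF assms(3)] sm sums_summable[OF s]] sums_unique[OF s] by simp
  finally show ?thesis .
qed

text \<open>The gap \<open>A - K\<close> is measured instead of comparing suprema: for a finite
  measure the two agree, and the gaps of countably many sets can be added.\<close>

definition inner_compact :: "'a topology \<Rightarrow> 'a measure \<Rightarrow> 'a set \<Rightarrow> bool" where
  "inner_compact T N A \<longleftrightarrow> (\<forall>e>0. \<exists>K. compactin T K \<and> K \<subseteq> A \<and> measure N (A - K) < e)"

context
  fixes T :: "'a topology" and N :: "'a measure"
  assumes T: "second_countable T" "Hausdorff_space T" "locally_compact_space T"
    and N: "finite_measure N" "sets N = sets (borel_of T)"
begin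

interpretation finite_measure N by (fact N)

lemma compactin_sets_borel_of: "compactin T K \<Longrightarrow> K \<in> sets N"
  using T(2) by (auto simp: N(2) intro!: borel_of_closedin compactin_imp_closedin)

text \<open>An infinite union of compact sets need not be compact, so it is cut off at a finite
  partial union \<open>F n\<close>; continuity from below makes this loss smaller than the half of
  \<open>e\<close> left over by the approximations.\<close>

lemma inner_compact_UN:
  fixes A :: "nat \<Rightarrow> 'a set"
  assumes A: "\<And>n. A n \<in> sets N" "\<And>n. inner_compact T N (A n)"
  shows "inner_compact T N (\<Union>n. A n)"
  unfolding inner_compact_def
proof (intro allI impI)
  fix e :: real assume e: "0 < e"
  have "\<exists>K. compactin T K \<and> K \<subseteq> A n \<and> measure N (A n - K) < e / 2 * (1 / 2) ^ Suc n" for n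
    using A(2)[unfolded inner_compact_def, rule_format, of "e / 2 * (1 / 2) ^ Suc n"] e by auto
  then obtain K where K: "\<And>n. compactin T (K n)" "\<And>n. K n \<subseteq> A n"
    "\<And>n. measure N (A n - K n) < e / 2 * (1 / 2) ^ Suc n"
    by metis
  note Ks = compactin_sets_borel_of[OF K(1)]
  define F where "F n = (\<Union>i\<le>n. K i)" for n
  have Fs: "F n \<in> sets N" for n
    using Ks by (auto simp: F_def)
  have U: "(\<Union>n. F n) = (\<Union>n. K n)"
    by (auto simp: F_def)
  have half: "measure N (\<Union>n. A n - K n) \<le> e / 2"
    using measure_UN_le_half[OF e, of "\<lambda>n. A n - K n"] A(1) Ks K(3) by auto
  have "(\<lambda>n. measure N (F n)) \<longlonglongrightarrow> measure N (\<Union>n. F n)"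
    using Fs by (intro finite_Lim_measure_incseq) (auto simp: F_def incseq_def intro: order_trans)
  then have "eventually (\<lambda>n. measure N (\<Union>n. F n) - e / 2 < measure N (F n)) sequentially"
    using e by (intro order_tendstoD) auto
  then obtain n where n: "measure N (\<Union>n. F n) - e / 2 < measure N (F n)"
    by (auto simp: eventually_sequentially)
  have "measure N ((\<Union>n. A n) - F n) \<le> measure N ((\<Union>n. A n - K n) \<union> ((\<Union>n. F n) - F n))"
    using A(1) Ks Fs U by (intro finite_measure_mono) (auto intro!: sets.Un sets.countable_UN sets.Diff)
  also have "\<dots> \<le> measure N (\<Union>n. A n - K n) + measure N ((\<Union>n. F n) - F n)"
    using A(1) Ks Fs by (intro measure_Un_le) auto
  also have "measure N ((\<Union>n. F n) - F n) = measure N (\<Union>n. F n) - measure N (F n)"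
    using Fs by (intro finite_measure_Diff) auto
  finally have "measure N ((\<Union>n. A n) - F n) < e"
    using half n by simp
  moreover have "compactin T (F n)"
    using K(1) by (auto simp: F_def intro!: compactin_Union)
  moreover have "F n \<subseteq> (\<Union>n. A n)"
    using K(2) by (auto simp: F_def)
  ultimately show "\<exists>K. compactin T K \<and> K \<subseteq> (\<Union>n. A n) \<and> measure N ((\<Union>n. A n) - K) < e"
    by blast
qed

text \<open>Here no truncation occurs: in a Hausdorff space the intersection of all
  \<open>K n\<close> is closed, and it sits inside the compact \<open>K 0\<close>.\<close>

lemma inner_compact_INT:
  fixes A :: "nat \<Rightarrow> 'a set"
  assumes A: "\<And>n. A n \<in> sets N" "\<And>n. inner_compact T N (A n)"
  shows "inner_compact T N (\<Inter>n. A n)"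
  unfolding inner_compact_def
proof (intro allI impI)
  fix e :: real assume e: "0 < e"
  have "\<exists>K. compactin T K \<and> K \<subseteq> A n \<and> measure N (A n - K) < e / 2 * (1 / 2) ^ Suc n" for n
    using A(2)[unfolded inner_compact_def, rule_format, of "e / 2 * (1 / 2) ^ Suc n"] e by auto
  then obtain K where K: "\<And>n. compactin T (K n)" "\<And>n. K n \<subseteq> A n"
    "\<And>n. measure N (A n - K n) < e / 2 * (1 / 2) ^ Suc n"
    by metis
  note Ks = compactin_sets_borel_of[OF K(1)]
  have "measure N ((\<Inter>n. A n) - (\<Inter>n. K n)) \<le> measure N (\<Union>n. A n - K n)"
    using A(1) Ks by (intro finite_measure_mono) (auto intro!: sets.countable_UN sets.Diff)
  also have "\<dots> \<le> e / 2"
    using measure_UN_le_half[OF e, of "\<lambda>n. A n - K n"] A(1) Ks K(3) by auto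
  finally have "measure N ((\<Inter>n. A n) - (\<Inter>n. K n)) < e"
    using e by simp
  moreover have "compactin T (\<Inter>n. K n)"
  proof (rule closed_compactin[OF K(1)[of 0]])
    show "closedin T (\<Inter>n. K n)"
      using K(1) T(2) by (intro closedin_INT compactin_imp_closedin) auto
  qed auto
  moreover have "(\<Inter>n. K n) \<subseteq> (\<Inter>n. A n)"
    using K(2) by auto
  ultimately show "\<exists>K. compactin T K \<and> K \<subseteq> (\<Inter>n. A n) \<and> measure N ((\<Inter>n. A n) - K) < e"
    by blast
qed

lemma inner_compact_compactin: "compactin T K \<Longrightarrow> inner_compact T N K"
  unfolding inner_compact_def by (metis Diff_cancel measure_empty order_refl)

text \<open>The class of sets approximable together with their complements is closed under complements,
  which inner approximability alone is not.\<close>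

lemma inner_compact_borel:
  assumes "A \<in> sets N"
  shows "inner_compact T N A"
proof -
  have open_inner: "inner_compact T N U" if "openin T U" for U
  proof -
    obtain K :: "nat \<Rightarrow> 'a set" where "\<And>n. compactin T (K n)" "U = (\<Union>n. K n)"
      using openin_sigma_compact[OF T \<open>openin T U\<close>] by metis
    then show ?thesis
      by (metis inner_compact_UN inner_compact_compactin compactin_sets_borel_of)
  qed
  have closed_inner: "inner_compact T N C" if C: "closedin T C" for C
  proof -
    obtain K :: "nat \<Rightarrow> 'a set" where K: "\<And>n. compactin T (K n)" "topspace T = (\<Union>n. K n)"
      using openin_sigma_compact[OF T openin_topspace] by metis
    have "C = (\<Union>n. C \<inter> K n)"
      using closedin_subset[OF C] K(2) by auto
    moreover have "compactin T (C \<inter> K n)" for n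
      using C K(1) by (rule closed_Int_compactin)
    then have "inner_compact T N (\<Union>n. C \<inter> K n)"
      by (intro inner_compact_UN inner_compact_compactin compactin_sets_borel_of)
    ultimately show ?thesis
      by simp
  qed
  have sp: "space N = topspace T"
    using sets_eq_imp_space_eq[OF N(2)] by simp
  have "A \<in> sigma_sets (topspace T) {U. openin T U}"
    using assms by (simp add: N(2) sets_borel_of)
  then have "A \<in> sets N \<and> inner_compact T N A \<and> inner_compact T N (topspace T - A)"
  proof induction
    case (Basic U)
    then have "closedin T (topspace T - U)" "openin T U"
      by auto
    then show ?case
      using open_inner closed_inner by (simp add: N(2) borel_of_openin)
  next
    case Empty
    then show ?case
      using open_inner by simp
  next
    case (Compl A)
    then have "topspace T - (topspace T - A) = A"
      using sets.sets_into_space[of A N] sp by (auto simp: double_diff)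
    moreover have "topspace T - A \<in> sets N"
      using Compl sp sets.compl_sets[of A N] by simp
    ultimately show ?case
      using Compl by simp
  next
    case (Union A)
    have "topspace T - (\<Union>n. A n) = (\<Inter>n. topspace T - A n)"
      by auto
    moreover have "topspace T - A n \<in> sets N" for n
      using Union sp sets.compl_sets[of "A n" N] by simp
    moreover have "(\<Union>n. A n) \<in> sets N"
      using Union by auto
    ultimately show ?case
      using Union inner_compact_UN[of A] inner_compact_INT[of "\<lambda>n. topspace T - A n"] by simp
  qed
  then show ?thesis
    by simp
qed

end

section \<open>Left invariant measures and multipliers\<close>

text \<open>Left invariance does not exclude the zero measure, for which a modulus can be any
  positive function. Every other sigma-finite measure has a weight with nonzero finite integral,
  which can be cancelled from equations between constants.\<close>

lemma (in sigma_finite_measure) AE_False_or_weight: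
  obtains "AE x in M. False"
  | w where "w \<in> borel_measurable M" "integral\<^sup>N M w \<noteq> 0" "integral\<^sup>N M w \<noteq> \<infinity>"
proof -
  obtain h where h: "h \<in> borel_measurable M" "integral\<^sup>N M h \<noteq> \<infinity>" "\<And>x. x \<in> space M \<Longrightarrow> 0 < h x"
    using Ex_finite_integrable_function by metis
  show thesis
  proof (cases "integral\<^sup>N M h = 0")
    case True
    then have "AE x in M. h x = 0"
      using h(1) by (simp add: nn_integral_0_iff_AE)
    with AE_space have "AE x in M. False"
      by eventually_elim (use h(3) in force)
    then show ?thesis
      using that by blast
  qed (use h that in blast)
qed

lemma (in sigma_finite_measure) sigma_finite_density_ennreal:
  assumes "(\<lambda>x. ennreal (f x)) \<in> borel_measurable M"
  shows "sigma_finite_measure (density M (\<lambda>x. ennreal (f x)))"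
  using assms by (subst sigma_finite_iff_density_finite) auto

section \<open>Multipliers as homomorphisms\<close>

context group
begin

lemma multiplier_one:
  assumes "multiplier G T \<kappa>"
  shows "\<kappa> \<one> = 1"
proof -
  have pos: "0 < \<kappa> \<one>"
    using assms one_closed unfolding multiplier_def by metis
  have "\<kappa> \<one> * \<kappa> \<one> = \<kappa> (\<one> \<otimes> \<one>)"
    using assms one_closed unfolding multiplier_def by metis
  also have "\<kappa> (\<one> \<otimes> \<one>) = \<kappa> \<one> * 1"
    by simp
  finally show ?thesis
    using pos unfolding mult_cancel_left by simp
qed

lemma multiplier_inv:
  assumes "multiplier G T \<kappa>" "g \<in> carrier G"
  shows "\<kappa> (inv g) = 1 / \<kappa> g"
proof -
  have "\<kappa> (g \<otimes> inv g) = \<kappa> g * \<kappa> (inv g)" "0 < \<kappa> g"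
    using assms inv_closed unfolding multiplier_def by blast+
  then show ?thesis
    using assms multiplier_one[OF assms(1)] by (simp add: field_simps)
qed

text \<open>The image of \<open>K\<close> is a compact, hence bounded, subgroup of the positive
  reals. An element above 1 would have unbounded powers, and an element below 1 has an inverse above
  1.\<close>

lemma multiplier_compact_subgroup:
  assumes "multiplier G T \<kappa>" "subgroup K G" "compactin T K" "k \<in> K"
  shows "\<kappa> k = 1"
proof -
  interpret K: subgroup K G by fact
  have "compactin euclideanreal (\<kappa> ` K)"
    using assms(1,3) image_compactin unfolding multiplier_def by blast
  then have "bounded (\<kappa> ` K)"
    using compact_imp_bounded by simp
  then obtain B where "\<forall>k\<in>K. \<bar>\<kappa> k\<bar> \<le> B"
    unfolding bounded_iff by auto
  then have B: "\<kappa> k \<le> B" if "k \<in> K" for k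
    using that abs_le_D1 by blast
  have le: "\<kappa> k \<le> 1" if k: "k \<in> K" for k
  proof (rule ccontr)
    assume "\<not> \<kappa> k \<le> 1"
    then obtain n where n: "B < \<kappa> k ^ n"
      using real_arch_pow[of "\<kappa> k" B] by auto
    have "k [^] i \<in> K \<and> \<kappa> (k [^] i) = \<kappa> k ^ i" for i :: nat
    proof (induction i)
      case 0
      then show ?case
        using multiplier_one[OF assms(1)] by simp
    next
      case (Suc i)
      then show ?case
        using assms(1) k by (simp add: multiplier_def)
    qed
    then show False
      using B n by (metis not_le)
  qed
  have "0 < \<kappa> k"
    using assms(1,4) by (simp add: multiplier_def)
  moreover have "1 / \<kappa> k \<le> 1"
    using le[of "inv k"] multiplier_inv[OF assms(1)] assms(4) by simp
  ultimately show ?thesis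
    using le[OF assms(4)] by (simp add: field_simps)
qed

end

section \<open>Measurable group operations and translation of integrals\<close>

locale left_invariant_group = lcsc_group G T + sigma_finite_measure \<mu>
  for G :: "('a, 'b) monoid_scheme" (structure) and T :: "'a topology" and \<mu> :: "'a measure" +
  assumes sets_mu [measurable_cong]: "sets \<mu> = sets (borel_of T)"
    and left_invariant: "left_invariant G \<mu>"
begin

lemma space_mu: "space \<mu> = carrier G"
  using sets_eq_imp_space_eq[OF sets_mu] topspace_eq by simp

text \<open>Joint continuity speaks of open sets of the product; second countability places these in
  the product sigma-algebra, as Fubini requires.\<close>

lemma measurable_mult [measurable (raw)]:
  assumes "f \<in> measurable M \<mu>" "g \<in> measurable M \<mu>"
  shows "(\<lambda>x. f x \<otimes> g x) \<in> measurable M \<mu>"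
proof -
  have "(\<lambda>(x, y). x \<otimes> y) \<in> measurable (borel_of T \<Otimes>\<^sub>M borel_of T) (borel_of T)"
    using second_countable continuous_mult by (rule measurable_pair_continuous_map)
  then have "(\<lambda>(x, y). x \<otimes> y) \<in> measurable (\<mu> \<Otimes>\<^sub>M \<mu>) \<mu>"
    using measurable_cong_sets[OF sets_pair_measure_cong[OF sets_mu sets_mu] sets_mu] by blast
  from measurable_compose[OF measurable_Pair[OF assms] this] show ?thesis
    by simp
qed

lemma measurable_inv [measurable (raw)]:
  assumes "f \<in> measurable M \<mu>"
  shows "(\<lambda>x. inv (f x)) \<in> measurable M \<mu>"
proof -
  have "(\<lambda>x. inv x) \<in> measurable (borel_of T) (borel_of T)"
    using continuous_inv by (rule measurable_borel_of_continuous_map)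
  then have "(\<lambda>x. inv x) \<in> measurable \<mu> \<mu>"
    using measurable_cong_sets[OF sets_mu sets_mu] by blast
  from measurable_compose[OF assms this] show ?thesis .
qed

lemma measurable_carrier_const [measurable (raw)]: "a \<in> carrier G \<Longrightarrow> (\<lambda>x. a) \<in> measurable M \<mu>"
  by (simp add: space_mu)

lemma distr_left_translation:
  assumes a: "a \<in> carrier G"
  shows "distr \<mu> \<mu> (\<lambda>x. a \<otimes> x) = \<mu>"
proof (rule measure_eqI)
  note [measurable] = a
  fix A assume "A \<in> sets (distr \<mu> \<mu> (\<lambda>x. a \<otimes> x))"
  then have A: "A \<in> sets \<mu>"
    by simp
  then have Ac: "A \<subseteq> carrier G"
    using sets.sets_into_space space_mu by blast
  have "(\<lambda>x. a \<otimes> x) -` A \<inter> space \<mu> = inv a <# A"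
  proof
    show "(\<lambda>x. a \<otimes> x) -` A \<inter> space \<mu> \<subseteq> inv a <# A"
    proof
      fix x assume "x \<in> (\<lambda>x. a \<otimes> x) -` A \<inter> space \<mu>"
      then have "a \<otimes> x \<in> A" "x = inv a \<otimes> (a \<otimes> x)"
        using a by (simp_all add: space_mu m_assoc[symmetric])
      then show "x \<in> inv a <# A"
        unfolding l_coset_def by blast
    qed
    show "inv a <# A \<subseteq> (\<lambda>x. a \<otimes> x) -` A \<inter> space \<mu>"
      using a Ac by (auto simp: l_coset_def space_mu m_assoc[symmetric])
  qed
  then show "emeasure (distr \<mu> \<mu> (\<lambda>x. a \<otimes> x)) A = emeasure \<mu> A"
    using A a left_invariant by (simp add: emeasure_distr left_invariant_def)
qed simp

lemma nn_integral_left_translation: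
  assumes a: "a \<in> carrier G" and [measurable]: "F \<in> borel_measurable \<mu>"
  shows "(\<integral>\<^sup>+x. F (a \<otimes> x) \<partial>\<mu>) = integral\<^sup>N \<mu> F"
proof -
  note [measurable] = a
  have "integral\<^sup>N (distr \<mu> \<mu> (\<lambda>x. a \<otimes> x)) F = (\<integral>\<^sup>+x. F (a \<otimes> x) \<partial>\<mu>)"
    by (intro nn_integral_distr) measurable
  then show ?thesis
    using distr_left_translation[OF a] by simp
qed

section \<open>The modulus and integration under inversion\<close>

context
  fixes \<Delta> :: "'a \<Rightarrow> real"
  assumes modulus: "right_modulus G \<mu> \<Delta>"
begin

lemma modulus_pos: "a \<in> carrier G \<Longrightarrow> 0 < \<Delta> a"
  using modulus by (simp add: right_modulus_def)

text \<open>The scaling property is applied to the preimage \<open>A #> inv a\<close>, whose right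
  translate by \<open>a\<close> is \<open>A\<close> again. This keeps the factor
  \<open>\<Delta> a\<close> and avoids \<open>\<Delta> (inv a)\<close>, whose relation to
  \<open>\<Delta> a\<close> is not yet available.\<close>

lemma distr_right_translation:
  assumes a: "a \<in> carrier G"
  shows "scale_measure (ennreal (\<Delta> a)) (distr \<mu> \<mu> (\<lambda>x. x \<otimes> a)) = \<mu>"
proof (rule measure_eqI)
  note [measurable] = a
  fix A assume "A \<in> sets (scale_measure (ennreal (\<Delta> a)) (distr \<mu> \<mu> (\<lambda>x. x \<otimes> a)))"
  then have A [measurable]: "A \<in> sets \<mu>"
    by simp
  then have Ac: "A \<subseteq> carrier G"
    using sets.sets_into_space space_mu by blast
  have eq: "(\<lambda>x. x \<otimes> a) -` A \<inter> space \<mu> = A #> inv a"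
  proof
    show "(\<lambda>x. x \<otimes> a) -` A \<inter> space \<mu> \<subseteq> A #> inv a"
    proof
      fix x assume "x \<in> (\<lambda>x. x \<otimes> a) -` A \<inter> space \<mu>"
      then have "x \<otimes> a \<in> A" "x = x \<otimes> a \<otimes> inv a"
        using a by (simp_all add: space_mu m_assoc)
      then show "x \<in> A #> inv a"
        unfolding r_coset_def by blast
    qed
    show "A #> inv a \<subseteq> (\<lambda>x. x \<otimes> a) -` A \<inter> space \<mu>"
      using a Ac by (auto simp: r_coset_def space_mu m_assoc subset_iff)
  qed
  have "(\<lambda>x. x \<otimes> a) -` A \<inter> space \<mu> \<in> sets \<mu>"
    by measurable
  then have "emeasure \<mu> ((A #> inv a) #> a) = ennreal (\<Delta> a) * emeasure \<mu> (A #> inv a)"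
    using a modulus by (simp add: right_modulus_def eq)
  moreover have "(A #> inv a) #> a = A"
    using a Ac by (simp add: coset_mult_assoc)
  ultimately show "emeasure (scale_measure (ennreal (\<Delta> a)) (distr \<mu> \<mu> (\<lambda>x. x \<otimes> a))) A = emeasure \<mu> A"
    by (simp add: emeasure_distr eq)
qed simp

lemma nn_integral_right_translation:
  assumes a: "a \<in> carrier G" and [measurable]: "F \<in> borel_measurable \<mu>"
  shows "integral\<^sup>N \<mu> F = ennreal (\<Delta> a) * (\<integral>\<^sup>+x. F (x \<otimes> a) \<partial>\<mu>)"
proof -
  note [measurable] = a
  have "integral\<^sup>N (scale_measure (ennreal (\<Delta> a)) (distr \<mu> \<mu> (\<lambda>x. x \<otimes> a))) F
      = ennreal (\<Delta> a) * integral\<^sup>N (distr \<mu> \<mu> (\<lambda>x. x \<otimes> a)) F"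
    by (intro nn_integral_scale_measure) simp
  also have "integral\<^sup>N (distr \<mu> \<mu> (\<lambda>x. x \<otimes> a)) F = (\<integral>\<^sup>+x. F (x \<otimes> a) \<partial>\<mu>)"
    by (intro nn_integral_distr) measurable
  finally show ?thesis
    using distr_right_translation[OF a] by simp
qed

context
  fixes w :: "'a \<Rightarrow> ennreal"
  assumes w [measurable]: "w \<in> borel_measurable \<mu>"
    and w_pos: "integral\<^sup>N \<mu> w \<noteq> 0" and w_fin: "integral\<^sup>N \<mu> w \<noteq> \<infinity>"
begin

text \<open>Exhibits \<open>\<Delta> a\<close> as a quotient of two integrals of a fixed weight,
  which is what makes the modulus visibly measurable in \<open>a\<close> and multiplicative.\<close>

lemma nn_integral_modulus:
  assumes a: "a \<in> carrier G"
  shows "(\<integral>\<^sup>+x. w (x \<otimes> inv a) \<partial>\<mu>) = ennreal (\<Delta> a) * integral\<^sup>N \<mu> w"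
proof -
  have [measurable]: "inv a \<in> carrier G"
    using a by simp
  have "(\<integral>\<^sup>+x. w (x \<otimes> inv a) \<partial>\<mu>) = ennreal (\<Delta> a) * (\<integral>\<^sup>+x. w (x \<otimes> a \<otimes> inv a) \<partial>\<mu>)"
    by (rule nn_integral_right_translation[OF a]) measurable
  also have "(\<integral>\<^sup>+x. w (x \<otimes> a \<otimes> inv a) \<partial>\<mu>) = integral\<^sup>N \<mu> w"
    using a by (intro nn_integral_cong) (simp add: space_mu m_assoc)
  finally show ?thesis .
qed

lemma modulus_measurable: "\<Delta> \<in> borel_measurable \<mu>"
proof -
  have "\<Delta> a = enn2real ((\<integral>\<^sup>+x. w (x \<otimes> inv a) \<partial>\<mu>) / integral\<^sup>N \<mu> w)" if "a \<in> space \<mu>" for a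
    using that modulus_pos[of a] w_pos w_fin
    by (simp add: nn_integral_modulus space_mu ennreal_mult_divide_eq less_imp_le)
  moreover have "(\<lambda>a. enn2real ((\<integral>\<^sup>+x. w (x \<otimes> inv a) \<partial>\<mu>) / integral\<^sup>N \<mu> w)) \<in> borel_measurable \<mu>"
    by measurable
  ultimately show ?thesis
    by (simp cong: measurable_cong)
qed

text \<open>The integral of \<open>w (x \<otimes> inv (a \<otimes> b))\<close> is evaluated at once
  by the modulus of the product, and by two right translations with those of the factors; the
  integral of \<open>w\<close> then cancels.\<close>

lemma modulus_mult:
  assumes a: "a \<in> carrier G" and b: "b \<in> carrier G"
  shows "\<Delta> (a \<otimes> b) = \<Delta> a * \<Delta> b"
proof -
  have [measurable]: "inv a \<in> carrier G" "inv b \<in> carrier G"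
    using a b by simp_all
  have "ennreal (\<Delta> (a \<otimes> b)) * integral\<^sup>N \<mu> w = (\<integral>\<^sup>+x. w (x \<otimes> inv (a \<otimes> b)) \<partial>\<mu>)"
    using a b by (simp add: nn_integral_modulus)
  also have "\<dots> = (\<integral>\<^sup>+x. w (x \<otimes> inv b \<otimes> inv a) \<partial>\<mu>)"
    using a b by (intro nn_integral_cong) (simp add: space_mu inv_mult_group m_assoc)
  also have "\<dots> = ennreal (\<Delta> b) * (\<integral>\<^sup>+x. w (x \<otimes> b \<otimes> inv b \<otimes> inv a) \<partial>\<mu>)"
    by (rule nn_integral_right_translation[OF b]) measurable
  also have "(\<integral>\<^sup>+x. w (x \<otimes> b \<otimes> inv b \<otimes> inv a) \<partial>\<mu>) = (\<integral>\<^sup>+x. w (x \<otimes> inv a) \<partial>\<mu>)"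
    using b by (intro nn_integral_cong) (simp add: space_mu m_assoc)
  also have "ennreal (\<Delta> b) * \<dots> = ennreal (\<Delta> a * \<Delta> b) * integral\<^sup>N \<mu> w"
    using a b modulus_pos[of a] modulus_pos[of b]
    by (simp add: nn_integral_modulus ennreal_mult less_imp_le mult_ac)
  finally have "integral\<^sup>N \<mu> w * ennreal (\<Delta> (a \<otimes> b)) = integral\<^sup>N \<mu> w * ennreal (\<Delta> a * \<Delta> b)"
    by (simp add: mult.commute)
  then have "ennreal (\<Delta> (a \<otimes> b)) = ennreal (\<Delta> a * \<Delta> b)"
    using w_pos w_fin by (simp add: ennreal_mult_cancel_left)
  then show ?thesis
    using a b modulus_pos[of "a \<otimes> b"] modulus_pos[of a] modulus_pos[of b] by (simp add: less_imp_le)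
qed

lemma modulus_inv:
  assumes a: "a \<in> carrier G"
  shows "\<Delta> (inv a) = 1 / \<Delta> a"
proof -
  have "\<Delta> \<one> * \<Delta> \<one> = \<Delta> (\<one> \<otimes> \<one>)"
    by (rule modulus_mult[symmetric]) simp_all
  also have "\<dots> = \<Delta> \<one> * 1"
    by simp
  finally have "\<Delta> \<one> = 1"
    using modulus_pos[of \<one>] unfolding mult_cancel_left by simp
  moreover have "\<Delta> (a \<otimes> inv a) = \<Delta> a * \<Delta> (inv a)"
    using a by (intro modulus_mult) simp_all
  ultimately show ?thesis
    using modulus_pos[OF a] a by (simp add: field_simps)
qed

text \<open>Both sides are multiplied by \<open>\<integral>w\<close>, and \<open>\<integral>w(yx) dy = \<integral>w / \<Delta>(x)\<close> turns the left one into a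
  double integral, where left translations in \<open>x\<close> and then in \<open>y\<close> separate the variables again.\<close>

lemma nn_integral_inv_weight:
  assumes [measurable]: "F \<in> borel_measurable \<mu>"
  shows "(\<integral>\<^sup>+x. F (inv x) \<partial>\<mu>) = (\<integral>\<^sup>+x. F x * ennreal (1 / \<Delta> x) \<partial>\<mu>)"
proof -
  interpret P: pair_sigma_finite \<mu> \<mu> ..
  note [measurable] = modulus_measurable
  let ?D = "\<lambda>x. ennreal (\<Delta> x)" and ?W = "integral\<^sup>N \<mu> w"
  have "(\<integral>\<^sup>+x. F (inv x) \<partial>\<mu>) * ?W = (\<integral>\<^sup>+x. F (inv x) * ?W \<partial>\<mu>)"
    by (rule nn_integral_multc[symmetric]) measurable
  also have "\<dots> = (\<integral>\<^sup>+x. (\<integral>\<^sup>+y. F (inv x) * ?D x * w (y \<otimes> x) \<partial>\<mu>) \<partial>\<mu>)"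
  proof (rule nn_integral_cong)
    fix x assume "x \<in> space \<mu>"
    then have x [measurable]: "x \<in> carrier G"
      by (simp add: space_mu)
    have "F (inv x) * ?W = F (inv x) * ?D x * (\<integral>\<^sup>+y. w (y \<otimes> x) \<partial>\<mu>)"
      by (simp add: nn_integral_right_translation[OF x w] mult.assoc)
    then show "F (inv x) * ?W = (\<integral>\<^sup>+y. F (inv x) * ?D x * w (y \<otimes> x) \<partial>\<mu>)"
      by (simp add: nn_integral_cmult)
  qed
  also have "\<dots> = (\<integral>\<^sup>+y. (\<integral>\<^sup>+x. F (inv x) * ?D x * w (y \<otimes> x) \<partial>\<mu>) \<partial>\<mu>)"
    by (rule P.Fubini'[symmetric]) measurable
  also have "\<dots> = (\<integral>\<^sup>+y. (\<integral>\<^sup>+x. F (inv x \<otimes> y) * ?D (inv y \<otimes> x) * w x \<partial>\<mu>) \<partial>\<mu>)"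
  proof (rule nn_integral_cong)
    fix y assume "y \<in> space \<mu>"
    then have y [measurable]: "y \<in> carrier G" and iy: "inv y \<in> carrier G"
      by (simp_all add: space_mu)
    have "(\<integral>\<^sup>+x. F (inv x) * ?D x * w (y \<otimes> x) \<partial>\<mu>)
        = (\<integral>\<^sup>+x. F (inv (inv y \<otimes> x)) * ?D (inv y \<otimes> x) * w (y \<otimes> (inv y \<otimes> x)) \<partial>\<mu>)"
      by (rule nn_integral_left_translation[OF iy, symmetric]) measurable
    also have "\<dots> = (\<integral>\<^sup>+x. F (inv x \<otimes> y) * ?D (inv y \<otimes> x) * w x \<partial>\<mu>)"
      using y by (intro nn_integral_cong) (simp add: space_mu inv_mult_group m_assoc[symmetric])
    finally show "(\<integral>\<^sup>+x. F (inv x) * ?D x * w (y \<otimes> x) \<partial>\<mu>)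
        = (\<integral>\<^sup>+x. F (inv x \<otimes> y) * ?D (inv y \<otimes> x) * w x \<partial>\<mu>)" .
  qed
  also have "\<dots> = (\<integral>\<^sup>+x. (\<integral>\<^sup>+y. F (inv x \<otimes> y) * ?D (inv y \<otimes> x) * w x \<partial>\<mu>) \<partial>\<mu>)"
    by (rule P.Fubini') measurable
  also have "\<dots> = (\<integral>\<^sup>+x. w x * (\<integral>\<^sup>+y. F y * ?D (inv y) \<partial>\<mu>) \<partial>\<mu>)"
  proof (rule nn_integral_cong)
    fix x assume "x \<in> space \<mu>"
    then have x [measurable]: "x \<in> carrier G"
      by (simp add: space_mu)
    have "(\<integral>\<^sup>+y. F (inv x \<otimes> y) * ?D (inv y \<otimes> x) * w x \<partial>\<mu>)
        = (\<integral>\<^sup>+y. F (inv x \<otimes> (x \<otimes> y)) * ?D (inv (x \<otimes> y) \<otimes> x) * w x \<partial>\<mu>)"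
      by (rule nn_integral_left_translation[OF x, symmetric]) measurable
    also have "\<dots> = (\<integral>\<^sup>+y. F y * ?D (inv y) * w x \<partial>\<mu>)"
      using x by (intro nn_integral_cong) (simp add: space_mu inv_mult_group m_assoc,
        simp add: m_assoc[symmetric])
    also have "\<dots> = w x * (\<integral>\<^sup>+y. F y * ?D (inv y) \<partial>\<mu>)"
      by (subst mult.commute, intro nn_integral_multc) measurable
    finally show "(\<integral>\<^sup>+y. F (inv x \<otimes> y) * ?D (inv y \<otimes> x) * w x \<partial>\<mu>)
        = w x * (\<integral>\<^sup>+y. F y * ?D (inv y) \<partial>\<mu>)" .
  qed
  also have "\<dots> = ?W * (\<integral>\<^sup>+y. F y * ?D (inv y) \<partial>\<mu>)"
    by (rule nn_integral_multc) measurable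
  also have "(\<integral>\<^sup>+y. F y * ?D (inv y) \<partial>\<mu>) = (\<integral>\<^sup>+y. F y * ennreal (1 / \<Delta> y) \<partial>\<mu>)"
    by (intro nn_integral_cong) (simp add: space_mu modulus_inv)
  finally show ?thesis
    using w_pos w_fin by (subst (asm) mult.commute) (simp add: ennreal_mult_cancel_left)
qed

end

text \<open>For the zero measure both sides vanish; otherwise an auxiliary weight exists, and the
  formula does not depend on it.\<close>

lemma nn_integral_inv:
  assumes "F \<in> borel_measurable \<mu>"
  shows "(\<integral>\<^sup>+x. F (inv x) \<partial>\<mu>) = (\<integral>\<^sup>+x. F x * ennreal (1 / \<Delta> x) \<partial>\<mu>)"
proof (rule AE_False_or_weight)
  assume "AE x in \<mu>. False"
  then show ?thesis
    by (intro nn_integral_cong_AE) (erule eventually_mono, simp)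
qed (rule nn_integral_inv_weight[OF _ _ _ assms])

end

end

section \<open>Coset spaces\<close>

context lcsc_group
begin

lemma lcoset_eq: "\<lbrakk>subgroup K G; x \<in> carrier G; y \<in> x <# K\<rbrakk> \<Longrightarrow> y <# K = x <# K"
  using l_repr_independence by blast

lemma lcosets_memD:
  assumes "subgroup K G" "c \<in> lcosets K" "g \<in> c"
  shows "g \<in> carrier G" "c = g <# K"
proof -
  obtain a where a: "a \<in> carrier G" "c = a <# K"
    using assms(2) by (auto simp: LCOSETS_def)
  then show "g \<in> carrier G"
    using assms(1,3) subgroup.elemlcos_carrier[OF assms(1) group_axioms] by blast
  show "c = g <# K"
    using a assms lcoset_eq by blast
qed

lemma lcosetsI: "g \<in> carrier G \<Longrightarrow> g <# K \<in> lcosets K"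
  by (auto simp: LCOSETS_def)

lemma topspace_coset_topology: "subgroup K G \<Longrightarrow> topspace (coset_topology G T K) = lcosets K"
  using quotient_imp_surjective_map[OF quotient_map_coset_topology, of K] topspace_eq
  by (simp add: LCOSETS_def UNION_singleton_eq_range)

lemma measurable_coset_projection:
  assumes "subgroup K G" "sets M = sets (borel_of T)"
  shows "(\<lambda>g. g <# K) \<in> measurable M (borel_of (coset_topology G T K))"
  using measurable_borel_of_continuous_map[OF quotient_imp_continuous_map[OF
      quotient_map_coset_topology[OF assms(1)]]] measurable_cong_sets[OF assms(2) refl] by blast

text \<open>The saturation of \<open>V\<close> is the union of its right translates by elements of
  \<open>K\<close>, and each of these is the preimage of \<open>V\<close> under a continuous right
  translation.\<close>

lemma openin_coset_image:
  assumes K: "subgroup K G" and V: "openin T V"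
  shows "openin (coset_topology G T K) ((\<lambda>g. g <# K) ` V)"
proof -
  have Vc: "V \<subseteq> carrier G"
    using openin_subset[OF V] topspace_eq by simp
  have Kc: "k \<in> carrier G" if "k \<in> K" for k
    using subgroup.mem_carrier[OF K that] .
  have "openin T {x \<in> topspace T. x \<otimes> k \<in> V}" if "k \<in> K" for k
  proof (rule openin_continuous_map_preimage[OF _ V])
    have "continuous_map T (prod_topology T T) (\<lambda>x. (x, k))"
      using Kc[OF that] topspace_eq by (intro continuous_map_pairedI) auto
    from continuous_map_compose[OF this continuous_mult]
    show "continuous_map T T (\<lambda>x. x \<otimes> k)"
      by (simp add: o_def)
  qed
  then have "openin T (\<Union>k\<in>K. {x \<in> topspace T. x \<otimes> k \<in> V})"
    by blast
  also have "(\<Union>k\<in>K. {x \<in> topspace T. x \<otimes> k \<in> V}) = \<Union>((\<lambda>g. g <# K) ` V)"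
  proof
    show "(\<Union>k\<in>K. {x \<in> topspace T. x \<otimes> k \<in> V}) \<subseteq> \<Union>((\<lambda>g. g <# K) ` V)"
    proof
      fix x assume "x \<in> (\<Union>k\<in>K. {x \<in> topspace T. x \<otimes> k \<in> V})"
      then obtain k where k: "k \<in> K" "x \<in> carrier G" "x \<otimes> k \<in> V"
        using topspace_eq by auto
      moreover have "x \<otimes> k \<in> x <# K"
        using k by (auto simp: l_coset_def)
      then have "(x \<otimes> k) <# K = x <# K"
        using K k(2) lcoset_eq by blast
      moreover have "x \<in> x <# K"
        using k(2) K by (rule lcos_self)
      ultimately show "x \<in> \<Union>((\<lambda>g. g <# K) ` V)"
        by blast
    qed
    show "\<Union>((\<lambda>g. g <# K) ` V) \<subseteq> (\<Union>k\<in>K. {x \<in> topspace T. x \<otimes> k \<in> V})"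
    proof
      fix x assume "x \<in> \<Union>((\<lambda>g. g <# K) ` V)"
      then obtain g k where g: "g \<in> V" "k \<in> K" "x = g \<otimes> k"
        by (auto simp: l_coset_def)
      then have "x \<in> topspace T" "x \<otimes> inv k = g"
        using Vc Kc topspace_eq by (auto simp: subset_iff m_assoc)
      moreover have "inv k \<in> K"
        using g(2) subgroup.m_inv_closed[OF K] by blast
      ultimately show "x \<in> (\<Union>k\<in>K. {x \<in> topspace T. x \<otimes> k \<in> V})"
        using g(1) by blast
    qed
  qed
  finally show ?thesis
    using Vc K by (auto simp: openin_coset_topology LCOSETS_def)
qed

text \<open>The saturation of \<open>C\<close> is the product set of \<open>C\<close> and
  \<open>K\<close>, the image of a compact set under multiplication, hence closed; a set of cosets
  is closed when its preimage is. This is where compactness of \<open>K\<close> enters.\<close>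

lemma coset_image_compact_borel:
  assumes K: "subgroup K G" "compactin T K" and C: "compactin T C"
  shows "(\<lambda>g. g <# K) ` C \<in> sets (borel_of (coset_topology G T K))"
proof (rule borel_of_closedin)
  let ?Q = "coset_topology G T K" and ?\<pi> = "\<lambda>g. g <# K"
  have Cc: "C \<subseteq> carrier G"
    using compactin_subset_topspace[OF C] topspace_eq by simp
  have "compactin (prod_topology T T) (C \<times> K)"
    using C K(2) by (simp add: compactin_Times)
  then have "compactin T ((\<lambda>(x, y). x \<otimes> y) ` (C \<times> K))"
    using continuous_mult by (rule image_compactin)
  then have "closedin T ((\<lambda>(x, y). x \<otimes> y) ` (C \<times> K))"
    using Hausdorff by (intro compactin_imp_closedin) auto
  also have "(\<lambda>(x, y). x \<otimes> y) ` (C \<times> K) = {x \<in> topspace T. ?\<pi> x \<in> ?\<pi> ` C}"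
  proof
    show "(\<lambda>(x, y). x \<otimes> y) ` (C \<times> K) \<subseteq> {x \<in> topspace T. ?\<pi> x \<in> ?\<pi> ` C}"
    proof clarify
      fix c k assume *: "c \<in> C" "k \<in> K"
      then have "c \<in> carrier G" "c \<otimes> k \<in> c <# K"
        using Cc by (auto simp: l_coset_def)
      then have "(c \<otimes> k) <# K = c <# K"
        using K(1) lcoset_eq by blast
      then show "c \<otimes> k \<in> topspace T \<and> ?\<pi> (c \<otimes> k) \<in> ?\<pi> ` C"
        using * Cc subgroup.mem_carrier[OF K(1)] topspace_eq by auto
    qed
    show "{x \<in> topspace T. ?\<pi> x \<in> ?\<pi> ` C} \<subseteq> (\<lambda>(x, y). x \<otimes> y) ` (C \<times> K)"
    proof
      fix x assume "x \<in> {x \<in> topspace T. ?\<pi> x \<in> ?\<pi> ` C}"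
      then obtain c where c: "c \<in> C" "x <# K = c <# K" "x \<in> carrier G"
        using topspace_eq by auto
      then have "x \<in> c <# K"
        using lcos_self[OF c(3) K(1)] by simp
      then show "x \<in> (\<lambda>(x, y). x \<otimes> y) ` (C \<times> K)"
        using c(1) by (auto simp: l_coset_def)
    qed
  qed
  finally have "closedin T {x \<in> topspace T. ?\<pi> x \<in> ?\<pi> ` C}" .
  moreover have "?\<pi> ` C \<subseteq> topspace ?Q"
    using Cc K(1) by (auto simp: topspace_coset_topology LCOSETS_def)
  ultimately show "closedin ?Q (?\<pi> ` C)"
    using quotient_map_coset_topology[OF K(1)] unfolding quotient_map_closedin by blast
qed

section \<open>Integration over the quotient by a compact subgroup\<close>

context
  fixes K :: "'a set" and M :: "'a measure"
  assumes K: "subgroup K G" "compactin T K"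
    and M: "sigma_finite_measure M" "sets M = sets (borel_of T)"
begin

lemma space_M: "space M = carrier G"
  using sets_eq_imp_space_eq[OF M(2)] topspace_eq by simp

text \<open>That \<open>S\<close> itself is Borel in the quotient would need a measurable section or Haar measure on \<open>K\<close>.
  Equality up to a null set suffices for integration and follows from inner regularity, because
  compact sets have closed images.\<close>

lemma coset_set_inner:
  assumes A: "{g \<in> carrier G. g <# K \<in> S} \<in> sets M"
  obtains B where "B \<in> sets (borel_of (coset_topology G T K))" "B \<subseteq> S"
    "AE g in M. g <# K \<in> S \<longrightarrow> g <# K \<in> B"
proof -
  interpret sigma_finite_measure M by (fact M)
  let ?A = "{g \<in> carrier G. g <# K \<in> S}"
  obtain h where h: "h \<in> borel_measurable M" "integral\<^sup>N M h \<noteq> \<infinity>" "\<And>x. x \<in> space M \<Longrightarrow> 0 < h x"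
    using Ex_finite_integrable_function by metis
  \<comment> \<open>Weighting by a positive integrable \<open>h\<close> gives a finite measure with
    the same null sets, so regularity of finite measures reaches the sigma-finite
    \<open>M\<close>.\<close>
  define N where "N = density M h"
  have N: "finite_measure N" "sets N = sets (borel_of T)"
  proof -
    have "emeasure N (space N) = integral\<^sup>N M h"
      unfolding N_def using h(1)
      by (simp add: emeasure_density cong: nn_integral_cong)
    then show "finite_measure N"
      using h(2) by (intro finite_measureI) simp
  qed (simp add: N_def M(2))
  interpret N: finite_measure N by (fact N)
  have AN: "?A \<in> sets N"
    using A by (simp add: N_def)
  have "\<forall>n. \<exists>C. compactin T C \<and> C \<subseteq> ?A \<and> measure N (?A - C) < 1 / real (Suc n)"
    using inner_compact_borel[OF second_countable Hausdorff locally_compact N AN]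
    unfolding inner_compact_def
    by (auto dest: spec[of _ "1 / real (Suc n)"])
  then obtain C where "\<forall>n. compactin T (C n) \<and> C n \<subseteq> ?A \<and> measure N (?A - C n) < 1 / real (Suc n)"
    by (rule choice[THEN exE])
  then have C: "\<And>n. compactin T (C n)" "\<And>n. C n \<subseteq> ?A"
    "\<And>n. measure N (?A - C n) < 1 / real (Suc n)"
    by simp_all
  have Cs: "C n \<in> sets N" for n
    using compactin_imp_closedin[OF Hausdorff C(1)] by (simp add: N(2) borel_of_closedin)
  let ?B = "\<Union>n. (\<lambda>g. g <# K) ` C n"
  have "measure N (?A - (\<Union>n. C n)) \<le> 1 / real (Suc n)" for n
  proof -
    have "measure N (?A - (\<Union>n. C n)) \<le> measure N (?A - C n)"
      using AN Cs by (intro N.finite_measure_mono) auto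
    then show ?thesis
      using C(3)[of n] by linarith
  qed
  then have "measure N (?A - (\<Union>n. C n)) \<le> 0"
    by (intro LIMSEQ_le_const[OF lim_1_over_n[THEN LIMSEQ_Suc]]) auto
  then have "emeasure N (?A - (\<Union>n. C n)) = 0"
    by (simp add: N.emeasure_eq_measure measure_le_0_iff)
  moreover have "?A - (\<Union>n. C n) \<in> sets N"
    using AN Cs by auto
  ultimately have "?A - (\<Union>n. C n) \<in> null_sets (density M h)"
    by (simp add: N_def null_sets_def)
  then have "AE g in M. g \<in> ?A - (\<Union>n. C n) \<longrightarrow> h g = 0"
    using h(1) by (simp add: null_sets_density_iff)
  with AE_space have "AE g in M. g <# K \<in> S \<longrightarrow> g <# K \<in> ?B"
  proof eventually_elim
    case (elim g)
    show ?case
    proof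
      assume "g <# K \<in> S"
      then have "g \<in> (\<Union>n. C n)"
        using elim h(3)[of g] space_M by auto
      then show "g <# K \<in> ?B"
        by blast
    qed
  qed
  moreover have "?B \<in> sets (borel_of (coset_topology G T K))"
    using coset_image_compact_borel[OF K C(1)] by blast
  moreover have "?B \<subseteq> S"
    using C(2) by blast
  ultimately show thesis
    using that by blast
qed

text \<open>The change of variables for image measures wants \<open>F\<close> Borel on the quotient,
  while only its pull-back is known to be measurable. Approximating the preimages of
  \<open>V\<close> and of its complement from inside leaves a null gap, so \<open>F\<close> is
  measurable for the completion of the image measure and agrees almost everywhere with a Borel
  function.\<close>

lemma nn_integral_coset_projection:
  fixes F :: "'a set \<Rightarrow> ennreal"
  assumes F: "(\<lambda>g. F (g <# K)) \<in> borel_measurable M"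
  shows "integral\<^sup>N (distr M (borel_of (coset_topology G T K)) (\<lambda>g. g <# K)) F
    = (\<integral>\<^sup>+g. F (g <# K) \<partial>M)"
proof -
  let ?\<pi> = "\<lambda>g. g <# K" and ?Q = "borel_of (coset_topology G T K)"
  let ?D = "distr M ?Q ?\<pi>"
  note \<pi> = measurable_coset_projection[OF K(1) M(2)]
  have sD: "space ?D = lcosets K"
    by (simp add: topspace_coset_topology[OF K(1)])
  have "F \<in> borel_measurable (completion ?D)"
  proof (rule measurableI)
    fix V :: "ennreal set" assume V: "V \<in> sets borel"
    let ?S = "F -` V \<inter> lcosets K" and ?S' = "F -` (- V) \<inter> lcosets K"
    have pre: "{g \<in> carrier G. ?\<pi> g \<in> F -` V' \<inter> lcosets K} \<in> sets M" if "V' \<in> sets borel" for V'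
    proof -
      have "{g \<in> carrier G. ?\<pi> g \<in> F -` V' \<inter> lcosets K} = (\<lambda>g. F (?\<pi> g)) -` V' \<inter> space M"
        using lcosetsI by (auto simp: space_M)
      then show ?thesis
        using measurable_sets[OF F that] by simp
    qed
    obtain B where B: "B \<in> sets ?Q" "B \<subseteq> ?S" "AE g in M. ?\<pi> g \<in> ?S \<longrightarrow> ?\<pi> g \<in> B"
      by (rule coset_set_inner[OF pre[OF V]])
    have "- V \<in> sets borel"
      using V by auto
    then obtain B' where B': "B' \<in> sets ?Q" "B' \<subseteq> ?S'" "AE g in M. ?\<pi> g \<in> ?S' \<longrightarrow> ?\<pi> g \<in> B'"
      by (rule coset_set_inner[OF pre])
    \<comment> \<open>The cosets missed by both inner approximations: a measurable set that contains
      \<open>?S - B\<close> and whose pull-back is null.\<close>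
    have N: "lcosets K - B - B' \<in> sets ?D"
      using B(1) B'(1) sets.top[of ?D] unfolding sD by auto
    have "AE c in ?D. c \<notin> lcosets K - B - B'"
    proof (subst AE_distr_iff[OF \<pi>])
      show "{c \<in> space ?Q. c \<notin> lcosets K - B - B'} \<in> sets ?Q"
        using sets.compl_sets[OF N] by (simp add: set_diff_eq)
      show "AE g in M. ?\<pi> g \<notin> lcosets K - B - B'"
        using B(3) B'(3) by eventually_elim auto
    qed
    then have "lcosets K - B - B' \<in> null_sets ?D"
      using N AE_iff_null_sets by blast
    moreover have "?S - B \<subseteq> lcosets K - B - B'"
      using B'(2) by auto
    ultimately have "?S - B \<in> null_sets (completion ?D)"
      unfolding null_sets_completion_iff2 by blast
    then have "B \<union> (?S - B) \<in> sets (completion ?D)"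
      using B(1) by (intro sets.Un) auto
    also have "B \<union> (?S - B) = F -` V \<inter> space (completion ?D)"
      using B(2) sD by auto
    finally show "F -` V \<inter> space (completion ?D) \<in> sets (completion ?D)" .
  qed simp
  then obtain F' where F': "F' \<in> borel_measurable ?D" "AE c in ?D. F c = F' c"
    using completion_ex_borel_measurable by metis
  \<comment> \<open>The integral depends only on the values almost everywhere, also for an integrand
    that is not Borel, so \<open>F\<close> may be exchanged for \<open>F'\<close>.\<close>
  have "integral\<^sup>N ?D F = integral\<^sup>N ?D F'"
    using F'(2) by (rule nn_integral_cong_AE)
  also have "\<dots> = (\<integral>\<^sup>+g. F' (?\<pi> g) \<partial>M)"
    using \<pi> F'(1) by (intro nn_integral_distr) simp_all
  also have "\<dots> = (\<integral>\<^sup>+g. F (?\<pi> g) \<partial>M)"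
    using AE_distrD[OF \<pi> F'(2)] by (intro nn_integral_cong_AE) auto
  finally show ?thesis .
qed

end

end

section \<open>Actions and cosets\<close>

lemma (in continuous_action) act_inv_iff:
  assumes "h \<in> carrier G" "x \<in> topspace X" "A \<subseteq> topspace X"
  shows "\<phi> (inv h) x \<in> A \<longleftrightarrow> x \<in> \<phi> h ` A"
proof -
  interpret group G
    using group_hom group_hom.axioms(1) by auto
  show ?thesis
  proof
    assume "\<phi> (inv h) x \<in> A"
    moreover have "\<phi> h (\<phi> (inv h) x) = x"
      using orbit_sym_aux[of "inv h" x "\<phi> (inv h) x"] assms by simp
    ultimately show "x \<in> \<phi> h ` A"
      by (metis imageI)
  next
    assume "x \<in> \<phi> h ` A"
    then obtain y where "y \<in> A" "x = \<phi> h y"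
      by blast
    then show "\<phi> (inv h) x \<in> A"
      using orbit_sym_aux[of h y x] assms by auto
  qed
qed

section \<open>Orbits seen from almost every point and coset\<close>

context
  fixes H :: "('h, 'b) monoid_scheme" (structure) and T :: "'h topology"
    and X :: "'x topology" and \<phi> :: "'h \<Rightarrow> 'x \<Rightarrow> 'x"
  assumes H: "lcsc_group H T" and act: "continuous_action H T X \<phi>"
begin

interpretation lcsc_group H T by (fact H)
interpretation continuous_action H T X \<phi> by (fact act)

lemma openin_inv_act:
  assumes "openin X U"
  shows "openin (prod_topology X T) {(x, h). x \<in> topspace X \<and> h \<in> carrier H \<and> \<phi> (inv h) x \<in> U}"
proof -
  have "continuous_map (prod_topology X T) (prod_topology T X) (\<lambda>p. (inv (snd p), fst p))"
    using continuous_map_compose[OF continuous_map_snd continuous_inv]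
    by (intro continuous_map_pairedI) (auto simp: o_def intro: continuous_map_fst)
  from continuous_map_compose[OF this continuous_act]
  have "continuous_map (prod_topology X T) X (\<lambda>p. \<phi> (inv (snd p)) (fst p))"
    by (simp add: o_def)
  from openin_continuous_map_preimage[OF this assms] show ?thesis
    by (simp add: topspace_eq case_prod_unfold mem_Times_iff)
qed

text \<open>Projections of measurable sets may fail to be measurable. For open \<open>U\<close>,
  however, the pairs \<open>(x, h)\<close> form an open set, hence a countable union of open
  rectangles, and the open coset projection turns these into open rectangles again.\<close>

lemma coset_orbit_open_measurable:
  assumes K: "subgroup K H" and U: "openin X U"
  shows "{(x, c). x \<in> topspace X \<and> c \<in> lcosets K \<and> (\<exists>h\<in>c. \<phi> (inv h) x \<in> U)}
    \<in> sets (borel_of X \<Otimes>\<^sub>M borel_of (coset_topology H T K))" (is "?E \<in> _")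
proof -
  let ?\<pi> = "\<lambda>h. h <# K"
  let ?W = "{(x, h). x \<in> topspace X \<and> h \<in> carrier H \<and> \<phi> (inv h) x \<in> U}"
  obtain \<B> A where \<B>: "countable \<B>" "\<And>V. V \<in> \<B> \<Longrightarrow> openin T V" "\<And>V. openin X (A V)"
    and W: "?W = (\<Union>V\<in>\<B>. A V \<times> V)"
    using openin_prod_second_countable[OF second_countable openin_inv_act[OF U]] by blast
  have "?E = (\<Union>V\<in>\<B>. A V \<times> ?\<pi> ` V)"
  proof (intro subset_antisym subsetI)
    fix p assume "p \<in> ?E"
    then obtain x c h where p: "p = (x, c)" "x \<in> topspace X" "c \<in> lcosets K" "h \<in> c" "\<phi> (inv h) x \<in> U"
      by blast
    note h = lcosets_memD[OF K p(3,4)]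
    have "(x, h) \<in> ?W"
      using p h by blast
    then obtain V where "V \<in> \<B>" "x \<in> A V" "h \<in> V"
      unfolding W by blast
    then show "p \<in> (\<Union>V\<in>\<B>. A V \<times> ?\<pi> ` V)"
      unfolding p(1) h(2) by blast
  next
    fix p assume "p \<in> (\<Union>V\<in>\<B>. A V \<times> ?\<pi> ` V)"
    then obtain V x h where p: "V \<in> \<B>" "p = (x, h <# K)" "x \<in> A V" "h \<in> V"
      by blast
    then have "(x, h) \<in> ?W"
      unfolding W by blast
    then have h: "x \<in> topspace X" "h \<in> carrier H" "\<phi> (inv h) x \<in> U"
      by auto
    moreover have "h \<in> h <# K" "h <# K \<in> lcosets K"
      using h(2) K lcos_self lcosetsI by blast+
    ultimately show "p \<in> ?E"
      unfolding p(2) by blast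
  qed
  moreover have "A V \<times> ?\<pi> ` V \<in> sets (borel_of X \<Otimes>\<^sub>M borel_of (coset_topology H T K))"
    if "V \<in> \<B>" for V
    using \<B>(2)[OF that] \<B>(3) K by (intro pair_measureI borel_of_openin openin_coset_image)
  ultimately show ?thesis
    using \<B>(1) by (simp add: image_subset_iff sets.countable_UN')
qed

text \<open>Each section is null, but the set itself need not be measurable. Writing \<open>S = C \<inter> U\<close> with \<open>C\<close>
  closed and \<open>U\<close> open, it suffices to reach \<open>U\<close> from one representative and to stay in \<open>C\<close> for all
  of them: both conditions are measurable, and the second is decided on a countable dense set of
  representatives.\<close>

lemma AE_coset_reaches:
  assumes K: "subgroup K H" and X: "Hausdorff_space X"
    and S: "S \<subseteq> topspace X" "locally_compact_space (subtopology X S)"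
    and M: "sets M = sets (borel_of X)" "sigma_finite_measure M"
    and P: "sets P = sets (borel_of (coset_topology H T K))" "sigma_finite_measure P"
    and null: "\<And>h. h \<in> carrier H \<Longrightarrow> topspace X - \<phi> h ` S \<in> null_sets M"
  shows "AE (x, c) in M \<Otimes>\<^sub>M P. \<exists>h\<in>c. \<phi> (inv h) x \<in> S"
proof -
  interpret M: sigma_finite_measure M by (fact M)
  interpret P: sigma_finite_measure P by (fact P)
  interpret MP: pair_sigma_finite M P ..
  \<comment> \<open>A locally compact subspace of a Hausdorff space is locally closed.\<close>
  obtain C U where CU: "closedin X C" "openin X U" "C \<inter> U = S"
    using locally_compact_subspace_closed_Int_openin[of X S] X S by blast
  have sM: "space M = topspace X"
    using sets_eq_imp_space_eq[OF M(1)] by simp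
  have sP: "space P = lcosets K"
    using sets_eq_imp_space_eq[OF P(1)] by (simp add: topspace_coset_topology[OF K])
  define V where "V = topspace X - C"
  have V: "openin X V"
    using CU(1) by (simp add: V_def openin_diff)
  define E where "E A = {(x, c). x \<in> topspace X \<and> c \<in> lcosets K \<and> (\<exists>h\<in>c. \<phi> (inv h) x \<in> A)}" for A
  define good where "good = (\<lambda>p. p \<in> E U \<and> p \<notin> E V)"
  have Es: "E A \<in> sets (M \<Otimes>\<^sub>M P)" if "openin X A" for A
    using coset_orbit_open_measurable[OF K that] sets_pair_measure_cong[OF M(1) P(1)]
    by (simp add: E_def)
  have "{p \<in> space (M \<Otimes>\<^sub>M P). good p} = E U \<inter> (space (M \<Otimes>\<^sub>M P) - E V)"
    using sets.sets_into_space[OF Es[OF CU(2)]] by (auto simp: good_def)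
  also have "\<dots> \<in> sets (M \<Otimes>\<^sub>M P)"
    using Es[OF CU(2)] Es[OF V] by auto
  finally have good: "{p \<in> space (M \<Otimes>\<^sub>M P). good p} \<in> sets (M \<Otimes>\<^sub>M P)" .
  have sect: "AE x in M. good (x, c)" if "c \<in> space P" for c
  proof -
    have c: "c \<in> lcosets K"
      using that sP by simp
    obtain h where h: "h \<in> carrier H" "c = h <# K"
      using c by (auto simp: LCOSETS_def)
    have hc: "h \<in> c"
      using h K lcos_self by blast
    have cc: "c \<subseteq> carrier H"
      using lcosets_memD(1)[OF K c] by blast
    obtain D where D: "countable D" "D \<subseteq> c" "subtopology T c closure_of D = c"
      using second_countable_imp_separable_space[OF second_countable_subtopology[OF second_countable, of c]]
        cc topspace_eq unfolding separable_space_def by (auto simp: Int_absorb1)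
    have "AE x in M. x \<notin> topspace X - \<phi> d ` S" if "d \<in> carrier H" for d
      using null[OF that] by (rule AE_not_in)
    then have "AE x in M. \<forall>d\<in>D. x \<notin> topspace X - \<phi> d ` S"
      using D(2) cc unfolding AE_ball_countable[OF D(1)] by blast
    moreover have "AE x in M. x \<notin> topspace X - \<phi> h ` S"
      using null[OF h(1)] by (rule AE_not_in)
    ultimately show ?thesis
      using AE_space
    proof eventually_elim
      case (elim x)
      then have x: "x \<in> topspace X"
        using sM by simp
      have "\<phi> (inv h) x \<in> S"
        using elim act_inv_iff[OF h(1) x S(1)] x by blast
      then have "(x, c) \<in> E U"
        using x c hc CU(3) by (auto simp: E_def)
      moreover have "(x, c) \<notin> E V"
      proof
        assume "(x, c) \<in> E V"
        then obtain h' where h': "h' \<in> c" "\<phi> (inv h') x \<in> V"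
          by (auto simp: E_def)
        \<comment> \<open>For fixed \<open>x\<close>, leaving \<open>C\<close> is an open condition
          on the representative, so a violation at \<open>h'\<close> produces one at some
          \<open>d\<close> in the dense set \<open>D\<close>, where \<open>x\<close> was chosen to
          reach \<open>S\<close>.\<close>
        have "continuous_map T (prod_topology X T) (\<lambda>h. (x, h))"
          using x by (intro continuous_map_pairedI) auto
        from openin_continuous_map_preimage[OF this openin_inv_act[OF V]]
        have "openin T {h \<in> carrier H. \<phi> (inv h) x \<in> V}"
          using x topspace_eq by simp
        then have "openin (subtopology T c) (c \<inter> {h \<in> carrier H. \<phi> (inv h) x \<in> V})"
          by (rule openin_subtopology_Int2)
        moreover have "h' \<in> c \<inter> {h \<in> carrier H. \<phi> (inv h) x \<in> V}"
          using h' cc by auto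
        moreover have "h' \<in> subtopology T c closure_of D"
          using h' D(3) by simp
        ultimately have "\<exists>d. d \<in> D \<and> d \<in> c \<inter> {h \<in> carrier H. \<phi> (inv h) x \<in> V}"
          unfolding in_closure_of by meson
        then obtain d where d: "d \<in> D" "\<phi> (inv d) x \<in> V"
          by auto
        have "\<phi> (inv d) x \<in> S"
          using elim(1) d(1) x D(2) cc act_inv_iff[OF _ x S(1)] by blast
        then show False
          using d(2) CU(3) by (auto simp: V_def)
      qed
      ultimately show ?case
        by (simp add: good_def)
    qed
  qed
  \<comment> \<open>The sections are controlled at fixed \<open>c\<close>, while the product rule
    asks for them at fixed \<open>x\<close>; measurability of \<open>good\<close> permits the
    exchange.\<close>
  have "AE p in M \<Otimes>\<^sub>M P. good p"
  proof (rule MP.AE_pair_measure[OF good])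
    have "{p \<in> space (M \<Otimes>\<^sub>M P). good (fst p, snd p)} \<in> sets (M \<Otimes>\<^sub>M P)"
      using good by simp
    then show "AE x in M. AE c in P. good (x, c)"
      using sect by (subst MP.AE_commute) (auto intro: AE_I2)
  qed
  then show ?thesis
  proof eventually_elim
    case (elim p)
    then obtain x c h where p: "p = (x, c)" "x \<in> topspace X" "c \<in> lcosets K" "h \<in> c"
        "\<phi> (inv h) x \<in> U" "\<phi> (inv h) x \<notin> V"
      by (auto simp: good_def E_def)
    have "\<phi> (inv h) x \<in> topspace X"
      using p(5) CU(2) openin_subset by blast
    then have "\<phi> (inv h) x \<in> S"
      using p(5,6) CU(3) by (auto simp: V_def)
    then show ?case
      using p by auto
  qed
qed

end

text \<open>Two representatives differ by a right factor \<open>k\<close> in \<open>K\<close>, which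
  acts on the point \<open>\<phi> (inv h) x\<close> through \<open>inv k\<close>. The function
  \<open>u\<close> is left abstract to cover both \<open>r\<close> and
  \<open>\<lambda>x. s (z x)\<close>.\<close>

lemma (in continuous_action) coset_representative_invariant:
  assumes K: "subgroup K G" "compactin T K" and \<kappa>: "multiplier G T \<kappa>"
    and S: "S \<subseteq> topspace X"
    and u: "\<And>k y. k \<in> K \<Longrightarrow> y \<in> S \<Longrightarrow> \<phi> k y \<in> S \<Longrightarrow> u (\<phi> k y) = u y"
    and h: "h \<in> carrier G" "h' \<in> h <# K"
    and x: "x \<in> topspace X" "\<phi> (inv h) x \<in> S" "\<phi> (inv h') x \<in> S"
  shows "\<kappa> h' = \<kappa> h" "u (\<phi> (inv h') x) = u (\<phi> (inv h) x)"
proof -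
  interpret group G
    using group_hom group_hom.axioms(1) by auto
  obtain k where k: "k \<in> K" "h' = h \<otimes> k"
    using h(2) by (auto simp: l_coset_def)
  then have kc: "k \<in> carrier G"
    using subgroup.mem_carrier[OF K(1)] by blast
  have "\<kappa> h' = \<kappa> h * \<kappa> k"
    using \<kappa> k(2) kc h(1) by (simp add: multiplier_def)
  then show "\<kappa> h' = \<kappa> h"
    using multiplier_compact_subgroup[OF \<kappa> K k(1)] by simp
  have "\<phi> (inv h') x = \<phi> (inv k) (\<phi> (inv h) x)"
    using k(2) kc h(1) x(1) composition_rule[of x "inv k" "inv h"] by (simp add: inv_mult_group)
  then show "u (\<phi> (inv h') x) = u (\<phi> (inv h) x)"
    using u[of "inv k"] x(2,3) subgroup.m_inv_closed[OF K(1) k(1)] by simp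
qed

section \<open>The density kernel\<close>

theorem theorem4p1:
  fixes H :: "('h, 'b) monoid_scheme" and TH :: "'h topology"
    and G :: "('g, 'c) monoid_scheme" and TG :: "'g topology"
    and TX :: "'x topology" and Xs :: "'x set"
    and \<phi> :: "'h \<Rightarrow> 'x \<Rightarrow> 'x" and \<psi> :: "'g \<Rightarrow> 'x \<Rightarrow> 'x"
    and r :: "'x \<Rightarrow> 'g" and s :: "'x \<Rightarrow> 'g" and f :: "'g \<Rightarrow> real"
    and lam :: "'x measure" and \<mu> :: "'g measure" and \<nu> :: "'x measure"
    and PiH :: "'h set measure"
    and \<chi>H :: "'h \<Rightarrow> real" and \<chi>G \<Delta> m :: "'g \<Rightarrow> real"
    and H0 :: "'h set" and G0 :: "'g set"
  defines "z \<equiv> orbit_part G \<psi> r"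
    and "p \<equiv> sampling_density H G \<phi> \<psi> Xs \<chi>H \<chi>G r s f"
    and "kern \<equiv> density_kernel H G \<phi> \<psi> Xs \<chi>H \<chi>G r s f (coset_prior G TG G0 m \<mu>)"
    and "q \<equiv> reference_density H G \<phi> \<psi> \<chi>H (\<lambda>g. \<chi>G g / m g) r s"
    and "q_coset \<equiv> coset_reference_density H G \<phi> \<psi> Xs \<chi>H (\<lambda>g. \<chi>G g / m g) r s"
  \<comment> \<open>spaces and groups\<close>
  assumes H: "lcsc_group H TH" and G: "lcsc_group G TG"
    and X: "Hausdorff_space TX" "locally_compact_space TX"
    and Xs: "Xs \<subseteq> topspace TX" "locally_compact_space (subtopology TX Xs)"
    and H_action: "continuous_action H TH TX \<phi>"
    and G_action: "continuous_action G TG (subtopology TX Xs) \<psi>"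
  \<comment> \<open>dominating measure and orbital decomposition\<close>
    and lam: "sets lam = sets (borel_of TX)" "sigma_finite_measure lam"
    and \<chi>H: "multiplier H TH \<chi>H" "relatively_invariant H \<phi> \<chi>H lam"
    and \<chi>G: "multiplier G TG \<chi>G" "relatively_invariant G \<psi> \<chi>G (restrict_space lam Xs)"
    and null: "\<And>h. h \<in> carrier H \<Longrightarrow> topspace TX - \<phi> h ` Xs \<in> null_sets lam"
    and \<mu>: "sets \<mu> = sets (borel_of TG)" "sigma_finite_measure \<mu>" "left_invariant G \<mu>"
    and \<Delta>: "right_modulus G \<mu> \<Delta>"
    and r: "\<And>x. x \<in> Xs \<Longrightarrow> r x \<in> carrier G"
      "\<And>g x. g \<in> carrier G \<Longrightarrow> x \<in> Xs \<Longrightarrow> r (\<psi> g x) = g \<otimes>\<^bsub>G\<^esub> r x"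
    and \<nu>: "sets \<nu> = sets (restrict_space lam (z ` Xs))" "sigma_finite_measure \<nu>"
    and correspondence: "(\<lambda>x. (r x, z x)) \<in> measurable (restrict_space lam Xs) (\<mu> \<Otimes>\<^sub>M \<nu>)"
      "(\<lambda>(g, z). \<psi> g z) \<in> measurable (\<mu> \<Otimes>\<^sub>M \<nu>) (restrict_space lam Xs)"
    and decomposition: "distr (restrict_space lam Xs) (\<mu> \<Otimes>\<^sub>M \<nu>) (\<lambda>x. (r x, z x)) =
      density \<mu> (\<lambda>g. ennreal (\<chi>G g)) \<Otimes>\<^sub>M \<nu>"
  \<comment> \<open>sampling model\<close>
    and s: "s \<in> measurable \<nu> \<mu>"
    and f: "f \<in> borel_measurable \<mu>" "\<And>g. g \<in> carrier G \<Longrightarrow> 0 \<le> f g"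
    and f_normalised: "(\<integral>\<^sup>+ x. ennreal (f (r x \<otimes>\<^bsub>G\<^esub> s (z x))) \<partial>restrict_space lam Xs) = 1"
    and H0: "subgroup H0 H" "compactin TH H0"
    and G0: "subgroup G0 G" "compactin TG G0"
    and f_inv: "\<And>g0 g. g0 \<in> G0 \<Longrightarrow> g \<in> carrier G \<Longrightarrow> f (g0 \<otimes>\<^bsub>G\<^esub> g) = f g"
    and r_inv: "\<And>h0 x. h0 \<in> H0 \<Longrightarrow> x \<in> Xs \<Longrightarrow> \<phi> h0 x \<in> Xs \<Longrightarrow> r (\<phi> h0 x) = r x"
    and s_inv: "\<And>h0 x. h0 \<in> H0 \<Longrightarrow> x \<in> Xs \<Longrightarrow> \<phi> h0 x \<in> Xs \<Longrightarrow> s (z (\<phi> h0 x)) = s (z x)"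
    and identifiable: "\<And>h h' g g'. h \<in> carrier H \<Longrightarrow> h' \<in> carrier H \<Longrightarrow>
        g \<in> carrier G \<Longrightarrow> g' \<in> carrier G \<Longrightarrow>
        density lam (\<lambda>x. ennreal (p x h g)) = density lam (\<lambda>x. ennreal (p x h' g')) \<longleftrightarrow>
        h <#\<^bsub>H\<^esub> H0 = h' <#\<^bsub>H\<^esub> H0 \<and> g <#\<^bsub>G\<^esub> G0 = g' <#\<^bsub>G\<^esub> G0"
  \<comment> \<open>prior\<close>
    and m: "multiplier G TG m"
    and PiH: "sets PiH = sets (borel_of (coset_topology H TH H0))" "sigma_finite_measure PiH"
  shows "((\<integral>\<^sup>+ g. ennreal (\<chi>G (inv\<^bsub>G\<^esub> g) * f (inv\<^bsub>G\<^esub> g)) \<partial>density \<mu> (\<lambda>g. ennreal (m g))) < \<infinity>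
           \<longleftrightarrow> (\<integral>\<^sup>+ g. ennreal (\<chi>G g * f g / (m g * \<Delta> g)) \<partial>\<mu>) < \<infinity>) \<and>
         ((\<integral>\<^sup>+ g. ennreal (\<chi>G (inv\<^bsub>G\<^esub> g) * f (inv\<^bsub>G\<^esub> g)) \<partial>density \<mu> (\<lambda>g. ennreal (m g))) < \<infinity>
           \<longrightarrow> (\<exists>C>0.
             (\<forall>h\<in>carrier H. \<forall>x\<in>\<phi> h ` Xs.
                kern x (h <#\<^bsub>H\<^esub> H0) = ennreal (C * q x h) \<and> q_coset x (h <#\<^bsub>H\<^esub> H0) = q x h) \<and>
             (AE (x, c) in lam \<Otimes>\<^sub>M PiH. kern x c = ennreal (C * q_coset x c))))"
proof -
  interpret H: lcsc_group H TH by (fact H)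
  interpret G: left_invariant_group G TG \<mu>
    using G \<mu> by (simp add: left_invariant_group_def left_invariant_group_axioms_def)
  interpret HA: continuous_action H TH TX \<phi> by (fact H_action)
  interpret GA: continuous_action G TG "subtopology TX Xs" \<psi> by (fact G_action)
  interpret \<nu>: sigma_finite_measure \<nu> by (fact \<nu>(2))
  note [measurable] = f(1) s

  have mult_measurable: "\<kappa> \<in> borel_measurable \<mu>" if "multiplier G TG \<kappa>" for \<kappa>
    using that borel_measurable_continuous_map[of TG \<kappa>] measurable_cong_sets[OF \<mu>(1) refl]
    unfolding multiplier_def by blast
  note [measurable] = mult_measurable[OF \<chi>G(1)] mult_measurable[OF m]
  have \<chi>G_pos: "g \<in> carrier G \<Longrightarrow> 0 < \<chi>G g" and m_pos: "g \<in> carrier G \<Longrightarrow> 0 < m g"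
    and \<chi>H_pos: "h \<in> carrier H \<Longrightarrow> 0 < \<chi>H h" for g h
    using \<chi>G(1) m \<chi>H(1) by (simp_all add: multiplier_def)
  have \<chi>G_mult: "\<chi>G (a \<otimes>\<^bsub>G\<^esub> b) = \<chi>G a * \<chi>G b" and m_mult: "m (a \<otimes>\<^bsub>G\<^esub> b) = m a * m b"
    if "a \<in> carrier G" "b \<in> carrier G" for a b
    using \<chi>G(1) m that by (simp_all add: multiplier_def)
  note \<chi>G_inv = G.multiplier_inv[OF \<chi>G(1)] and m_inv = G.multiplier_inv[OF m]

  have space_lam: "space lam = topspace TX"
    using sets_eq_imp_space_eq[OF lam(1)] by simp
  have z_Xs: "z x \<in> Xs" if "x \<in> Xs" for x
    using GA.element_image[of "inv\<^bsub>G\<^esub> r x" x] r(1)[OF that] that Xs(1)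
    by (auto simp: z_def orbit_part_def)
  have s_carrier: "s w \<in> carrier G" if "w \<in> space \<nu>" for w
    using measurable_space[OF s that] by (simp add: G.space_mu)
  have sz_carrier: "s (z x) \<in> carrier G" if "x \<in> Xs" for x
  proof (rule s_carrier)
    show "z x \<in> space \<nu>"
      using that z_Xs[OF that] Xs(1) sets_eq_imp_space_eq[OF \<nu>(1)]
      by (auto simp: space_restrict_space space_lam)
  qed

  \<comment> \<open>The future constant, kept in the extended reals so that the kernel can be
    computed as \<open>I\<close> times the reference density; it becomes a real number once it is
    finite.\<close>
  define I where "I = (\<integral>\<^sup>+ g. ennreal (\<chi>G (inv\<^bsub>G\<^esub> g) * f (inv\<^bsub>G\<^esub> g)) \<partial>density \<mu> (\<lambda>g. ennreal (m g)))"
  have I_eq: "I = (\<integral>\<^sup>+ g. ennreal (m g * (\<chi>G (inv\<^bsub>G\<^esub> g) * f (inv\<^bsub>G\<^esub> g))) \<partial>\<mu>)"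
    unfolding I_def by (subst nn_integral_density)
      (auto intro!: nn_integral_cong simp: G.space_mu ennreal_mult' m_pos less_imp_le)

  \<comment> \<open>Writing \<open>g\<close> as a double inverse in the argument of \<open>m\<close>
    makes the integrand a function of the inverse of \<open>g\<close>, ready for the inversion
    formula.\<close>
  have "I = (\<integral>\<^sup>+ g. ennreal (m (inv\<^bsub>G\<^esub> (inv\<^bsub>G\<^esub> g)) * (\<chi>G (inv\<^bsub>G\<^esub> g) * f (inv\<^bsub>G\<^esub> g))) \<partial>\<mu>)"
    unfolding I_eq by (intro nn_integral_cong) (simp add: G.space_mu)
  also have "\<dots> = (\<integral>\<^sup>+ g. ennreal (m (inv\<^bsub>G\<^esub> g) * (\<chi>G g * f g)) * ennreal (1 / \<Delta> g) \<partial>\<mu>)"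
    by (rule G.nn_integral_inv[OF \<Delta>]) measurable
  also have "\<dots> = (\<integral>\<^sup>+ g. ennreal (\<chi>G g * f g / (m g * \<Delta> g)) \<partial>\<mu>)"
  proof (rule nn_integral_cong)
    fix g assume "g \<in> space \<mu>"
    then have g: "g \<in> carrier G"
      by (simp add: G.space_mu)
    have "ennreal (m (inv\<^bsub>G\<^esub> g) * (\<chi>G g * f g)) * ennreal (1 / \<Delta> g)
        = ennreal (m (inv\<^bsub>G\<^esub> g) * (\<chi>G g * f g) * (1 / \<Delta> g))"
      using G.modulus_pos[OF \<Delta> g] by (intro ennreal_mult''[symmetric]) simp
    then show "ennreal (m (inv\<^bsub>G\<^esub> g) * (\<chi>G g * f g)) * ennreal (1 / \<Delta> g)
        = ennreal (\<chi>G g * f g / (m g * \<Delta> g))"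
      using m_inv[OF g] by simp
  qed
  finally have I_modulus: "I = (\<integral>\<^sup>+ g. ennreal (\<chi>G g * f g / (m g * \<Delta> g)) \<partial>\<mu>)" .

  \<comment> \<open>A vanishing \<open>I\<close> concerns \<open>f\<close> at inverses, whereas the
    normalisation integrates right translates of \<open>f\<close> by values of \<open>s\<close>.
    Inversion and right translation change integrals only by the modulus and so preserve null
    functions; Fubini in the orbital decomposition then gives 0 for an integral equal to 1.\<close>
  have I_pos: "I \<noteq> 0"
  proof
    assume "I = 0"
    then have "AE g in \<mu>. ennreal (m g * (\<chi>G (inv\<^bsub>G\<^esub> g) * f (inv\<^bsub>G\<^esub> g))) = 0"
      unfolding I_eq by (subst (asm) nn_integral_0_iff_AE) simp_all
    with AE_space have f_inv_0: "AE g in \<mu>. ennreal (f (inv\<^bsub>G\<^esub> g)) = 0"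
    proof eventually_elim
      case (elim g)
      then have g: "g \<in> carrier G" "inv\<^bsub>G\<^esub> g \<in> carrier G"
        by (simp_all add: G.space_mu)
      show ?case
        using elim(2) m_pos[OF g(1)] \<chi>G_pos[OF g(2)] f(2)[OF g(2)]
        by (simp add: ennreal_eq_0_iff mult_le_0_iff)
    qed
    have "(\<integral>\<^sup>+ g. ennreal (f g) \<partial>\<mu>) = (\<integral>\<^sup>+ g. ennreal (f (inv\<^bsub>G\<^esub> (inv\<^bsub>G\<^esub> g))) \<partial>\<mu>)"
      by (intro nn_integral_cong) (simp add: G.space_mu)
    also have "\<dots> = (\<integral>\<^sup>+ g. ennreal (f (inv\<^bsub>G\<^esub> g)) * ennreal (1 / \<Delta> g) \<partial>\<mu>)"
      by (rule G.nn_integral_inv[OF \<Delta>]) measurable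
    also have "\<dots> = (\<integral>\<^sup>+ g. 0 \<partial>\<mu>)"
      using f_inv_0 by (intro nn_integral_cong_AE) (erule eventually_mono, simp)
    finally have f_0: "(\<integral>\<^sup>+ g. ennreal (f g) \<partial>\<mu>) = 0"
      by simp
    have zero: "(\<integral>\<^sup>+ g. ennreal (f (g \<otimes>\<^bsub>G\<^esub> a)) \<partial>density \<mu> (\<lambda>g. ennreal (\<chi>G g))) = 0"
      if a [measurable]: "a \<in> carrier G" for a
    proof -
      have "ennreal (\<Delta> a) * (\<integral>\<^sup>+ g. ennreal (f (g \<otimes>\<^bsub>G\<^esub> a)) \<partial>\<mu>) = 0"
        using G.nn_integral_right_translation[OF \<Delta> a, of "\<lambda>g. ennreal (f g)"] f_0 by simp
      then have "(\<integral>\<^sup>+ g. ennreal (f (g \<otimes>\<^bsub>G\<^esub> a)) \<partial>\<mu>) = 0"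
        using G.modulus_pos[OF \<Delta> a] by (simp add: ennreal_eq_0_iff)
      then have "AE g in \<mu>. ennreal (f (g \<otimes>\<^bsub>G\<^esub> a)) = 0"
        by (subst (asm) nn_integral_0_iff_AE) simp_all
      then show ?thesis
        by (subst nn_integral_density; simp add: nn_integral_0_iff_AE) (erule eventually_mono, simp)
    qed
    interpret \<chi>G\<mu>: sigma_finite_measure "density \<mu> (\<lambda>g. ennreal (\<chi>G g))"
      by (rule G.sigma_finite_density_ennreal) measurable
    interpret P: pair_sigma_finite "density \<mu> (\<lambda>g. ennreal (\<chi>G g))" \<nu> ..
    let ?F = "\<lambda>(g, w). ennreal (f (g \<otimes>\<^bsub>G\<^esub> s w))"
    have F [measurable]: "?F \<in> borel_measurable (\<mu> \<Otimes>\<^sub>M \<nu>)"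
      by measurable
    have "1 = (\<integral>\<^sup>+ x. ?F (r x, z x) \<partial>restrict_space lam Xs)"
      using f_normalised by simp
    also have "\<dots> = integral\<^sup>N (distr (restrict_space lam Xs) (\<mu> \<Otimes>\<^sub>M \<nu>) (\<lambda>x. (r x, z x))) ?F"
      using correspondence(1) F by (intro nn_integral_distr[symmetric]) simp_all
    also have "\<dots> = (\<integral>\<^sup>+ w. (\<integral>\<^sup>+ g. ?F (g, w) \<partial>density \<mu> (\<lambda>g. ennreal (\<chi>G g))) \<partial>\<nu>)"
      unfolding decomposition by (rule P.nn_integral_snd[symmetric]) measurable
    also have "\<dots> = (\<integral>\<^sup>+ w. 0 \<partial>\<nu>)"
      using zero s_carrier by (intro nn_integral_cong) simp
    finally show False
      by simp
  qed

  have q_coset_eq: "q_coset x (h <#\<^bsub>H\<^esub> H0) = q x h"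
    and kern_eq: "kern x (h <#\<^bsub>H\<^esub> H0) = I * ennreal (q x h)"
    if h: "h \<in> carrier H" and x: "x \<in> \<phi> h ` Xs" for h x
  proof -
    define y where "y = \<phi> (inv\<^bsub>H\<^esub> h) x"
    have x_TX: "x \<in> topspace TX"
      using x h Xs(1) HA.element_image by blast
    have y: "y \<in> Xs"
      using HA.act_inv_iff[OF h x_TX Xs(1)] x by (simp add: y_def)
    have h_mem: "h \<in> h <#\<^bsub>H\<^esub> H0"
      using h H0(1) by (rule H.lcos_self)
    have repr: "\<chi>H h' = \<chi>H h" "r (\<phi> (inv\<^bsub>H\<^esub> h') x) = r y" "s (z (\<phi> (inv\<^bsub>H\<^esub> h') x)) = s (z y)"
      if "h' \<in> h <#\<^bsub>H\<^esub> H0" "\<phi> (inv\<^bsub>H\<^esub> h') x \<in> Xs" for h'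
      using HA.coset_representative_invariant[OF H0 \<chi>H(1) Xs(1) _ h that(1) x_TX y[unfolded y_def] that(2),
          of r] r_inv
        HA.coset_representative_invariant[OF H0 \<chi>H(1) Xs(1) _ h that(1) x_TX y[unfolded y_def] that(2),
          of "\<lambda>x. s (z x)"] s_inv
      by (simp_all add: y_def)
    have q_repr: "q x h' = q x h" if "h' \<in> h <#\<^bsub>H\<^esub> H0" "\<phi> (inv\<^bsub>H\<^esub> h') x \<in> Xs" for h'
      using repr[OF that] by (simp add: q_def reference_density_def Let_def y_def z_def)
    show "q_coset x (h <#\<^bsub>H\<^esub> H0) = q x h"
      unfolding q_coset_def coset_reference_density_def q_def[symmetric]
    proof (rule the_equality)
      show "\<exists>h'\<in>h <#\<^bsub>H\<^esub> H0. \<phi> (inv\<^bsub>H\<^esub> h') x \<in> Xs \<and> q x h = q x h'"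
        using h_mem y[unfolded y_def] by blast
    qed (use q_repr in blast)

    define a where "a = r y \<otimes>\<^bsub>G\<^esub> s (z y)"
    have ryc: "r y \<in> carrier G" and syc: "s (z y) \<in> carrier G"
      using r(1) sz_carrier y by blast+
    then have a [measurable]: "a \<in> carrier G"
      by (simp add: a_def)
    \<comment> \<open>The right factor \<open>k\<close> of the representative becomes a left factor,
      its inverse, inside \<open>f\<close>, where \<open>f\<close> is invariant under
      \<open>G0\<close>; \<open>\<chi>G k\<close> is 1 because \<open>G0\<close> is compact.\<close>
    have p_eq: "p x h' (g \<otimes>\<^bsub>G\<^esub> k) = 1 / (\<chi>H h * \<chi>G g) * f (inv\<^bsub>G\<^esub> g \<otimes>\<^bsub>G\<^esub> a)"
      if h': "h' \<in> h <#\<^bsub>H\<^esub> H0" "\<phi> (inv\<^bsub>H\<^esub> h') x \<in> Xs" and g: "g \<in> carrier G" and k: "k \<in> G0" for h' g k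
    proof -
      have kc: "k \<in> carrier G" "inv\<^bsub>G\<^esub> k \<in> G0"
        using k subgroup.mem_carrier[OF G0(1)] subgroup.m_inv_closed[OF G0(1)] by blast+
      have "inv\<^bsub>G\<^esub> (g \<otimes>\<^bsub>G\<^esub> k) \<otimes>\<^bsub>G\<^esub> r y \<otimes>\<^bsub>G\<^esub> s (z y) = inv\<^bsub>G\<^esub> k \<otimes>\<^bsub>G\<^esub> (inv\<^bsub>G\<^esub> g \<otimes>\<^bsub>G\<^esub> a)"
        using g kc ryc syc by (simp add: a_def G.inv_mult_group G.m_assoc)
      moreover have "\<chi>G (g \<otimes>\<^bsub>G\<^esub> k) = \<chi>G g"
        using \<chi>G_mult[OF g kc(1)] G.multiplier_compact_subgroup[OF \<chi>G(1) G0 k] by simp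
      ultimately show ?thesis
        using repr[OF h'] h'(2) f_inv[OF kc(2)] g a
        by (simp add: p_def sampling_density_def Let_def z_def[symmetric])
    qed
    let ?F = "\<lambda>k. ennreal (coset_sampling_density H G \<phi> \<psi> Xs \<chi>H \<chi>G r s f x (h <#\<^bsub>H\<^esub> H0) k)"
    have F_eq: "?F (g <#\<^bsub>G\<^esub> G0) = ennreal (1 / (\<chi>H h * \<chi>G g) * f (inv\<^bsub>G\<^esub> g \<otimes>\<^bsub>G\<^esub> a))"
      if g: "g \<in> carrier G" for g
      unfolding coset_sampling_density_def p_def[symmetric]
    proof (rule arg_cong[where f = ennreal], rule the_equality)
      have "\<one>\<^bsub>G\<^esub> \<in> G0"
        using subgroup.one_closed[OF G0(1)] .
      then have "1 / (\<chi>H h * \<chi>G g) * f (inv\<^bsub>G\<^esub> g \<otimes>\<^bsub>G\<^esub> a) = p x h g"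
        using p_eq[OF h_mem y[unfolded y_def] g] g by (metis G.r_one)
      then show "\<exists>h'\<in>h <#\<^bsub>H\<^esub> H0. \<exists>g'\<in>g <#\<^bsub>G\<^esub> G0. \<phi> (inv\<^bsub>H\<^esub> h') x \<in> Xs \<and>
          1 / (\<chi>H h * \<chi>G g) * f (inv\<^bsub>G\<^esub> g \<otimes>\<^bsub>G\<^esub> a) = p x h' g'"
        using h_mem y[unfolded y_def] G.lcos_self[OF g G0(1)] by blast
    next
      fix v
      assume "\<exists>h'\<in>h <#\<^bsub>H\<^esub> H0. \<exists>g'\<in>g <#\<^bsub>G\<^esub> G0. \<phi> (inv\<^bsub>H\<^esub> h') x \<in> Xs \<and> v = p x h' g'"
      then obtain h' k where "h' \<in> h <#\<^bsub>H\<^esub> H0" "\<phi> (inv\<^bsub>H\<^esub> h') x \<in> Xs" "k \<in> G0" "v = p x h' (g \<otimes>\<^bsub>G\<^esub> k)"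
        unfolding l_coset_def[of G] by blast
      then show "v = 1 / (\<chi>H h * \<chi>G g) * f (inv\<^bsub>G\<^esub> g \<otimes>\<^bsub>G\<^esub> a)"
        using p_eq g by simp
    qed
    \<comment> \<open>The quotient of \<open>\<chi>G\<close> by \<open>m\<close> is multiplicative,
      so its values at \<open>r y\<close> and \<open>s (z y)\<close> merge into its value at
      \<open>a\<close>.\<close>
    have q_eq: "q x h = m a / (\<chi>H h * \<chi>G a)"
      using \<chi>G_mult[OF ryc syc] m_mult[OF ryc syc] m_pos[OF ryc] m_pos[OF syc]
      by (simp add: q_def reference_density_def Let_def y_def[symmetric] z_def[symmetric] a_def)
    have q_nonneg: "0 \<le> q x h"
      using q_eq m_pos[OF a] \<chi>G_pos[OF a] \<chi>H_pos[OF h] by simp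
    let ?J = "\<lambda>g. ennreal (m g * (1 / (\<chi>H h * \<chi>G g) * f (inv\<^bsub>G\<^esub> g \<otimes>\<^bsub>G\<^esub> a)))"
    have "kern x (h <#\<^bsub>H\<^esub> H0) = (\<integral>\<^sup>+ g. ?F (g <#\<^bsub>G\<^esub> G0) \<partial>density \<mu> (\<lambda>g. ennreal (m g)))"
      unfolding kern_def density_kernel_def coset_prior_def
    proof (rule G.nn_integral_coset_projection[OF G0])
      show "sigma_finite_measure (density \<mu> (\<lambda>g. ennreal (m g)))"
        by (rule G.sigma_finite_density_ennreal) measurable
      show "sets (density \<mu> (\<lambda>g. ennreal (m g))) = sets (borel_of TG)"
        by (simp add: \<mu>(1))
      \<comment> \<open>Measurability is read off the explicit formula on the group, not from the
        definite description on cosets.\<close>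
      have "(\<lambda>g. ennreal (1 / (\<chi>H h * \<chi>G g) * f (inv\<^bsub>G\<^esub> g \<otimes>\<^bsub>G\<^esub> a))) \<in> borel_measurable \<mu>"
        by measurable
      then have "(\<lambda>g. ?F (g <#\<^bsub>G\<^esub> G0)) \<in> borel_measurable \<mu>"
        by (rule measurable_cong[THEN iffD2, rotated]) (rule F_eq, simp add: G.space_mu)
      then show "(\<lambda>g. ?F (g <#\<^bsub>G\<^esub> G0)) \<in> borel_measurable (density \<mu> (\<lambda>g. ennreal (m g)))"
        by simp
    qed
    also have "\<dots> = (\<integral>\<^sup>+ g. ennreal (1 / (\<chi>H h * \<chi>G g) * f (inv\<^bsub>G\<^esub> g \<otimes>\<^bsub>G\<^esub> a)) \<partial>density \<mu> (\<lambda>g. ennreal (m g)))"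
      using F_eq by (intro nn_integral_cong) (simp add: G.space_mu)
    also have "\<dots> = (\<integral>\<^sup>+ g. ennreal (m g) * ennreal (1 / (\<chi>H h * \<chi>G g) * f (inv\<^bsub>G\<^esub> g \<otimes>\<^bsub>G\<^esub> a)) \<partial>\<mu>)"
      by (rule nn_integral_density) measurable
    also have "\<dots> = integral\<^sup>N \<mu> ?J"
      by (intro nn_integral_cong ennreal_mult'[symmetric]) (simp add: G.space_mu m_pos less_imp_le)
    also have "\<dots> = (\<integral>\<^sup>+ u. ?J (a \<otimes>\<^bsub>G\<^esub> u) \<partial>\<mu>)"
      by (rule G.nn_integral_left_translation[OF a, symmetric]) measurable
    also have "\<dots> = (\<integral>\<^sup>+ u. ennreal (q x h) * ennreal (m u * (\<chi>G (inv\<^bsub>G\<^esub> u) * f (inv\<^bsub>G\<^esub> u))) \<partial>\<mu>)"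
    proof (rule nn_integral_cong)
      fix u assume "u \<in> space \<mu>"
      then have u: "u \<in> carrier G"
        by (simp add: G.space_mu)
      have "inv\<^bsub>G\<^esub> (a \<otimes>\<^bsub>G\<^esub> u) \<otimes>\<^bsub>G\<^esub> a = inv\<^bsub>G\<^esub> u"
        using a u by (simp add: G.inv_mult_group G.m_assoc)
      then show "?J (a \<otimes>\<^bsub>G\<^esub> u) = ennreal (q x h) * ennreal (m u * (\<chi>G (inv\<^bsub>G\<^esub> u) * f (inv\<^bsub>G\<^esub> u)))"
        using q_nonneg by (simp add: \<chi>G_mult[OF a u] m_mult[OF a u] \<chi>G_inv[OF u] q_eq ennreal_mult'[symmetric] field_simps)
    qed
    also have "\<dots> = ennreal (q x h) * I"
      unfolding I_eq by (intro nn_integral_cmult) measurable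
    finally show "kern x (h <#\<^bsub>H\<^esub> H0) = I * ennreal (q x h)"
      by (simp add: mult.commute)
  qed

  have "\<exists>C>0. (\<forall>h\<in>carrier H. \<forall>x\<in>\<phi> h ` Xs.
          kern x (h <#\<^bsub>H\<^esub> H0) = ennreal (C * q x h) \<and> q_coset x (h <#\<^bsub>H\<^esub> H0) = q x h) \<and>
        (AE (x, c) in lam \<Otimes>\<^sub>M PiH. kern x c = ennreal (C * q_coset x c))" if fin: "I < \<infinity>"
  proof (intro exI conjI)
    \<comment> \<open>The constant of proportionality is \<open>enn2real I\<close>, and it is the
      same for every \<open>x\<close> and coset.\<close>
    have I_real: "I = ennreal (enn2real I)"
      using fin by simp
    show "0 < enn2real I"
      using I_pos fin by (simp add: enn2real_positive_iff zero_less_iff_neq_zero)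
    have repr: "kern x (h <#\<^bsub>H\<^esub> H0) = ennreal (enn2real I * q x h) \<and> q_coset x (h <#\<^bsub>H\<^esub> H0) = q x h"
      if "h \<in> carrier H" "x \<in> \<phi> h ` Xs" for h x
      using kern_eq[OF that] q_coset_eq[OF that] I_real by (metis enn2real_nonneg ennreal_mult')
    then show "\<forall>h\<in>carrier H. \<forall>x\<in>\<phi> h ` Xs.
        kern x (h <#\<^bsub>H\<^esub> H0) = ennreal (enn2real I * q x h) \<and> q_coset x (h <#\<^bsub>H\<^esub> H0) = q x h"
      by blast
    \<comment> \<open>The representative that carries \<open>x\<close> into \<open>Xs\<close> may
      depend on \<open>x\<close>; neither \<open>kern\<close> nor \<open>q_coset\<close> sees the
      choice, so the pointwise identity applies to almost every pair.\<close>
    have "AE p in lam \<Otimes>\<^sub>M PiH. case p of (x, c) \<Rightarrow> \<exists>h\<in>c. \<phi> (inv\<^bsub>H\<^esub> h) x \<in> Xs"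
      by (rule AE_coset_reaches[OF H H_action H0(1) X(1) Xs lam PiH null])
    with AE_space show "AE (x, c) in lam \<Otimes>\<^sub>M PiH. kern x c = ennreal (enn2real I * q_coset x c)"
    proof eventually_elim
      case (elim p)
      obtain x c where p: "p = (x, c)"
        by (cases p)
      obtain h where h: "h \<in> c" "\<phi> (inv\<^bsub>H\<^esub> h) x \<in> Xs"
        using elim(2) p by auto
      have x: "x \<in> topspace TX" and c: "c \<in> lcosets\<^bsub>H\<^esub> H0"
        using elim(1) p sets_eq_imp_space_eq[OF PiH(1)]
        by (auto simp: space_pair_measure space_lam H.topspace_coset_topology[OF H0(1)])
      note hc = H.lcosets_memD[OF H0(1) c h(1)]
      have "x \<in> \<phi> h ` Xs"
        using HA.act_inv_iff[OF hc(1) x Xs(1)] h(2) by simp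
      from repr[OF hc(1) this] show ?case
        by (simp add: p hc(2))
    qed
  qed
  then show ?thesis
    using I_modulus by (simp add: I_def)
qed

end
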